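(* Let $\mathcal H$ be a real Hilbert space, $M\in\mathcal M(\mathcal H)$, $\beta\ge 0$, let $A:\mathcal H\to 2^{\mathcal H}$ be maximally monotone, let $C:\mathcal H\to\mathcal H$ be $\frac1\beta$-cocoercive with respect to $\|\cdot\|_M$, and assume that $\operatorname{zer}(A+C)=\{x\in\mathcal H: 0\in Ax+Cx\}$ is nonempty. Let $\varepsilon>0$, $\epsilon_0,\epsilon_1\ge0$, $\lambda_0>0$, and suppose that the parameters of Algorithm 1 (described in the context) satisfy, for all $n\in\mathbb N$: $\mu_n=\frac1{\lambda_0}\lambda_n^2-\lambda_n$; $0\le\zeta_n\le1-\epsilon_0$; $\varepsilon\le\gamma_n\bar\beta\le4-2\lambda_0-\varepsilon$; $\lambda_{n+1}\ge\lambda_n$; $\gamma_{n+1}\lambda_{n+1}-\gamma_n\lambda_n\le\gamma_{n+1}\lambda_0-\epsilon_1$; and $\bar\beta\ge\beta$. Let $x^\star$ be an arbitrary point of $\operatorname{zer}(A+C)$ and, for sequences generated by Algorithm 1, let $\ell_n$ be as defined there, $$\phi_n=\Big\langle \tfrac{z_n-p_n}{\gamma_n},\,p_n-x^\star\Big\rangle_M+\tfrac{\bar\beta}{4}\|y_n-p_n\|_M^2,\qquad V_0=\|x_0-x^\star\|_M^2,$$ $$V_{n+1}=\|x_{n+1}-x^\star\|_M^2+2\lambda_{n+1}\gamma_{n+1}\alpha_{n+1}\phi_n+\ell_n\qquad(n\in\mathbb N).$$ Then the following hold: (i) the sequence $(V_n)_{n\in\mathbb N}$ is convergent and $\ell_n\le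 V_{n+1}\le\|x_0-x^\star\|_M^2$ for all $n\in\mathbb N$; (ii) if $(\lambda_n)_{n\in\mathbb N}$ is increasing and $\lambda_n\to\infty$ as $n\to\infty$, then for all $n\in\mathbb N$ $$\Big\|p_n-x_n+\alpha_n(x_n-p_{n-1})+\tfrac{\gamma_n\bar\beta\lambda_n^2}{\hat\theta_n}u_n-\tfrac{2\bar\theta_n}{\theta_n}v_n\Big\|_M^2\le\frac{2\lambda_0\|x_0-x^\star\|_M^2}{(4-\gamma_n\bar\beta-2\lambda_0)\lambda_n^2};$$ (iii) if $\epsilon_0>0$, then $(\ell_n)_{n\in\mathbb N}$ is summable; (iv) if $\epsilon_0>0$, then $\lambda_nu_n\to0$, $\lambda_nv_n\to0$, and $x_{n+1}-x_n\to0$ as $n\to\infty$; (v) if $\epsilon_1>0$, then $(\phi_n)_{n\in\mathbb N}$ is summable; (vi) if $\epsilon_1>0$ and $\bar\beta>\beta$, then $(\|y_n-p_n\|_M^2)_{n\in\mathbb N}$ is summable; (vii) if $\epsilon_0,\epsilon_1>0$, $(\lambda_n)_{n\in\mathbb N}$ is bounded, and $p_n-x_n\to0$, $y_n-p_n\to0$, and $z_n-p_n\to0$ as $n\to\infty$, then $(p_n)_{n\in\mathbb N}$ converges weakly to a point of $\operatorname{zer}(A+C)$; (viii) if $\epsilon_0,\epsilon_1>0$ and $(\lambda_n)_{n\in\mathbb N}$ is constant, then $(p_n)_{n\in\mathbb N}$ converges weakly to a point of $\operatorname{zer}(A+C)$.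
   Context: $\mathbb N=\{0,1,2,\dots\}$. $\mathcal M(\mathcal H)$ is the set of bounded linear, self-adjoint, strongly positive operators on $\mathcal H$; for $M\in\mathcal M(\mathcal H)$, $\langle x,y\rangle_M=\langle x,My\rangle$, $\|x\|_M=\sqrt{\langle x,Mx\rangle}$ and $\|x\|_{M^{-1}}=\sqrt{\langle x,M^{-1}x\rangle}$. $C$ is $\frac1\beta$-cocoercive ($\beta\ge0$) w.r.t. $\|\cdot\|_M$ if $\beta\langle Cx-Cy,x-y\rangle\ge\|Cx-Cy\|_{M^{-1}}^2$ for all $x,y\in\mathcal H$. Algorithm 1. Input: $x_0\in\mathcal H$; strictly positive sequences $(\gamma_n)_{n\in\mathbb N}$, $(\lambda_n)_{n\in\mathbb N}$; non-negative sequences $(\zeta_n)_{n\in\mathbb N}$, $(\mu_n)_{n\in\mathbb N}$; $\bar\beta\ge\beta\ge0$; $M\in\mathcal M(\mathcal H)$. Set $\gamma_{-1}=\gamma_0$ and, for $n\in\mathbb N$, $\alpha_n=\frac{\mu_n}{\lambda_n+\mu_n}$, $\bar\alpha_n=\frac{\gamma_n\mu_n}{\gamma_{n-1}(\lambda_n+\mu_n)}$, $\theta_n=(4-\gamma_n\bar\beta)(\lambda_n+\mu_n)-2\lambda_n^2$, $\hat\theta_n=2\lambda_n+2\mu_n-\gamma_n\bar\beta\lambda_n^2$, $\bar\theta_n=\lambda_n+\mu_n-\lambda_n^2$, $\tilde\theta_n=(\lambda_n+\mu_n)\gamma_n\bar\beta$. Initialize $y_{-1}=p_{-1}=z_{-1}=x_0$,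 $u_0=v_0=0$. For $n=0,1,2,\dots$: $$y_n=x_n+\alpha_n(y_{n-1}-x_n)+u_n,$$ $$z_n=x_n+\alpha_n(p_{n-1}-x_n)+\bar\alpha_n(z_{n-1}-p_{n-1})+\tfrac{\bar\theta_n\gamma_n\bar\beta}{\hat\theta_n}u_n+v_n,$$ $$p_n=(M+\gamma_nA)^{-1}(Mz_n-\gamma_nCy_n),$$ $$x_{n+1}=x_n+\lambda_n(p_n-z_n)+\bar\alpha_n\lambda_n(z_{n-1}-p_{n-1}),$$ and then choose any $u_{n+1},v_{n+1}\in\mathcal H$ satisfying the safeguarding condition $$(\lambda_{n+1}+\mu_{n+1})\Big(\tfrac{\tilde\theta_{n+1}}{\hat\theta_{n+1}}\|u_{n+1}\|_M^2+\tfrac{\hat\theta_{n+1}}{\theta_{n+1}}\|v_{n+1}\|_M^2\Big)\le\zeta_{n+1}\ell_n,$$ where $$\ell_n=\tfrac{\theta_n}{2}\Big\|p_n-x_n+\alpha_n(x_n-p_{n-1})+\tfrac{\gamma_n\bar\beta\lambda_n^2}{\hat\theta_n}u_n-\tfrac{2\bar\theta_n}{\theta_n}v_n\Big\|_M^2+2\mu_n\gamma_n\Big\langle\tfrac{z_n-p_n}{\gamma_n}-\tfrac{z_{n-1}-p_{n-1}}{\gamma_{n-1}},p_n-p_{n-1}\Big\rangle_M+\tfrac{\mu_n\gamma_n\bar\beta}{2}\|p_n-y_n-(p_{n-1}-y_{n-1})\|_M^2.$$ *)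

theory Defs
  imports "HOL-Analysis.Analysis"
begin

definition strongly_positive_op :: "('a::real_inner \<Rightarrow> 'a) \<Rightarrow> bool" where
  "strongly_positive_op M \<longleftrightarrow>
     bounded_linear M \<and> (\<forall>x y. inner (M x) y = inner x (M y)) \<and>
     (\<exists>c>0. \<forall>x. c * (norm x)\<^sup>2 \<le> inner x (M x))"

definition inner_wrt :: "('a::real_inner \<Rightarrow> 'a) \<Rightarrow> 'a \<Rightarrow> 'a \<Rightarrow> real" where
  "inner_wrt M x y = inner x (M y)"

definition norm_wrt :: "('a::real_inner \<Rightarrow> 'a) \<Rightarrow> 'a \<Rightarrow> real" where
  "norm_wrt M x = sqrt (inner x (M x))"

definition monotone_op :: "('a::real_inner \<Rightarrow> 'a set) \<Rightarrow> bool" where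
  "monotone_op A \<longleftrightarrow> (\<forall>x y. \<forall>a\<in>A x. \<forall>b\<in>A y. 0 \<le> inner (a - b) (x - y))"

definition maximally_monotone :: "('a::real_inner \<Rightarrow> 'a set) \<Rightarrow> bool" where
  "maximally_monotone A \<longleftrightarrow>
     monotone_op A \<and> (\<forall>B. monotone_op B \<and> (\<forall>x. A x \<subseteq> B x) \<longrightarrow> B = A)"

(* (1/\<beta>)-cocoercivity with respect to the M-norm, written multiplied by \<beta> so that \<beta> = 0
   is meaningful (C is then constant). On a complete space a strongly positive M is bijective,
   so inv M is the inverse operator. *)
definition cocoercive_wrt :: "('a::real_inner \<Rightarrow> 'a) \<Rightarrow> real \<Rightarrow> ('a \<Rightarrow> 'a) \<Rightarrow> bool" where
  "cocoercive_wrt M \<beta> C \<longleftrightarrow>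
     (\<forall>x y. \<beta> * inner (C x - C y) (x - y) \<ge> (norm_wrt (inv M) (C x - C y))\<^sup>2)"

definition zer_sum :: "('a::real_inner \<Rightarrow> 'a set) \<Rightarrow> ('a \<Rightarrow> 'a) \<Rightarrow> 'a set" where
  "zer_sum A C = {x. 0 \<in> (\<lambda>a. a + C x) ` A x}"

(* The set-valued inverse of M + \<gamma> A. For maximally monotone A, strongly positive M and
   \<gamma> > 0 every value is a singleton. *)
definition inverse_sum ::
  "('a::real_inner \<Rightarrow> 'a) \<Rightarrow> real \<Rightarrow> ('a \<Rightarrow> 'a set) \<Rightarrow> 'a \<Rightarrow> 'a set" where
  "inverse_sum M \<gamma> A w = {q. w \<in> (\<lambda>a. M q + \<gamma> *\<^sub>R a) ` A q}"

definition weakly_convergent_to :: "(nat \<Rightarrow> 'a::real_inner) \<Rightarrow> 'a \<Rightarrow> bool" where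
  "weakly_convergent_to s q \<longleftrightarrow> (\<forall>w. (\<lambda>n. inner (s n) w) \<longlonglongrightarrow> inner q w)"

(* prev c f n is the term f(n - 1) of a sequence extended to index -1 by the value c. *)
definition prev :: "'b \<Rightarrow> (nat \<Rightarrow> 'b) \<Rightarrow> nat \<Rightarrow> 'b" where
  "prev c f n = (case n of 0 \<Rightarrow> c | Suc k \<Rightarrow> f k)"

(* lam is the relaxation sequence \<lambda>, bb is \<beta>-bar. *)

definition alpha :: "(nat \<Rightarrow> real) \<Rightarrow> (nat \<Rightarrow> real) \<Rightarrow> nat \<Rightarrow> real" where
  "alpha lam \<mu> n = \<mu> n / (lam n + \<mu> n)"

definition alpha_bar ::
  "(nat \<Rightarrow> real) \<Rightarrow> (nat \<Rightarrow> real) \<Rightarrow> (nat \<Rightarrow> real) \<Rightarrow> nat \<Rightarrow> real" where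
  "alpha_bar \<gamma> lam \<mu> n = \<gamma> n * \<mu> n / (prev (\<gamma> 0) \<gamma> n * (lam n + \<mu> n))"

definition theta ::
  "real \<Rightarrow> (nat \<Rightarrow> real) \<Rightarrow> (nat \<Rightarrow> real) \<Rightarrow> (nat \<Rightarrow> real) \<Rightarrow> nat \<Rightarrow> real" where
  "theta bb \<gamma> lam \<mu> n = (4 - \<gamma> n * bb) * (lam n + \<mu> n) - 2 * (lam n)\<^sup>2"

definition theta_hat ::
  "real \<Rightarrow> (nat \<Rightarrow> real) \<Rightarrow> (nat \<Rightarrow> real) \<Rightarrow> (nat \<Rightarrow> real) \<Rightarrow> nat \<Rightarrow> real" where
  "theta_hat bb \<gamma> lam \<mu> n = 2 * lam n + 2 * \<mu> n - \<gamma> n * bb * (lam n)\<^sup>2"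

definition theta_bar :: "(nat \<Rightarrow> real) \<Rightarrow> (nat \<Rightarrow> real) \<Rightarrow> nat \<Rightarrow> real" where
  "theta_bar lam \<mu> n = lam n + \<mu> n - (lam n)\<^sup>2"

definition theta_tilde ::
  "real \<Rightarrow> (nat \<Rightarrow> real) \<Rightarrow> (nat \<Rightarrow> real) \<Rightarrow> (nat \<Rightarrow> real) \<Rightarrow> nat \<Rightarrow> real" where
  "theta_tilde bb \<gamma> lam \<mu> n = (lam n + \<mu> n) * \<gamma> n * bb"

definition residual ::
  "real \<Rightarrow> (nat \<Rightarrow> real) \<Rightarrow> (nat \<Rightarrow> real) \<Rightarrow> (nat \<Rightarrow> real) \<Rightarrow>
   (nat \<Rightarrow> 'a::real_inner) \<Rightarrow> (nat \<Rightarrow> 'a) \<Rightarrow> (nat \<Rightarrow> 'a) \<Rightarrow> (nat \<Rightarrow> 'a) \<Rightarrow> nat \<Rightarrow> 'a" where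
  "residual bb \<gamma> lam \<mu> x p u v n =
     p n - x n + alpha lam \<mu> n *\<^sub>R (x n - prev (x 0) p n)
     + (\<gamma> n * bb * (lam n)\<^sup>2 / theta_hat bb \<gamma> lam \<mu> n) *\<^sub>R u n
     - (2 * theta_bar lam \<mu> n / theta bb \<gamma> lam \<mu> n) *\<^sub>R v n"

definition ell ::
  "('a::real_inner \<Rightarrow> 'a) \<Rightarrow> real \<Rightarrow> (nat \<Rightarrow> real) \<Rightarrow> (nat \<Rightarrow> real) \<Rightarrow> (nat \<Rightarrow> real) \<Rightarrow>
   (nat \<Rightarrow> 'a) \<Rightarrow> (nat \<Rightarrow> 'a) \<Rightarrow> (nat \<Rightarrow> 'a) \<Rightarrow> (nat \<Rightarrow> 'a) \<Rightarrow> (nat \<Rightarrow> 'a) \<Rightarrow> (nat \<Rightarrow> 'a) \<Rightarrow>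
   nat \<Rightarrow> real" where
  "ell M bb \<gamma> lam \<mu> x y z p u v n =
     theta bb \<gamma> lam \<mu> n / 2 * (norm_wrt M (residual bb \<gamma> lam \<mu> x p u v n))\<^sup>2
     + 2 * \<mu> n * \<gamma> n *
         inner_wrt M
           ((1 / \<gamma> n) *\<^sub>R (z n - p n)
             - (1 / prev (\<gamma> 0) \<gamma> n) *\<^sub>R (prev (x 0) z n - prev (x 0) p n))
           (p n - prev (x 0) p n)
     + \<mu> n * \<gamma> n * bb / 2 *
         (norm_wrt M (p n - y n - (prev (x 0) p n - prev (x 0) y n)))\<^sup>2"

definition algorithm_run ::
  "('a::real_inner \<Rightarrow> 'a) \<Rightarrow> ('a \<Rightarrow> 'a set) \<Rightarrow> ('a \<Rightarrow> 'a) \<Rightarrow> real \<Rightarrow>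
   (nat \<Rightarrow> real) \<Rightarrow> (nat \<Rightarrow> real) \<Rightarrow> (nat \<Rightarrow> real) \<Rightarrow> (nat \<Rightarrow> real) \<Rightarrow>
   (nat \<Rightarrow> 'a) \<Rightarrow> (nat \<Rightarrow> 'a) \<Rightarrow> (nat \<Rightarrow> 'a) \<Rightarrow> (nat \<Rightarrow> 'a) \<Rightarrow> (nat \<Rightarrow> 'a) \<Rightarrow> (nat \<Rightarrow> 'a) \<Rightarrow>
   bool" where
  "algorithm_run M A C bb \<gamma> lam \<mu> \<zeta> x y z p u v \<longleftrightarrow>
     u 0 = 0 \<and> v 0 = 0 \<and>
     (\<forall>n. y n = x n + alpha lam \<mu> n *\<^sub>R (prev (x 0) y n - x n) + u n) \<and>
     (\<forall>n. z n = x n + alpha lam \<mu> n *\<^sub>R (prev (x 0) p n - x n)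
            + alpha_bar \<gamma> lam \<mu> n *\<^sub>R (prev (x 0) z n - prev (x 0) p n)
            + (theta_bar lam \<mu> n * \<gamma> n * bb / theta_hat bb \<gamma> lam \<mu> n) *\<^sub>R u n + v n) \<and>
     (\<forall>n. p n \<in> inverse_sum M (\<gamma> n) A (M (z n) - \<gamma> n *\<^sub>R C (y n))) \<and>
     (\<forall>n. x (Suc n) = x n + lam n *\<^sub>R (p n - z n)
            + (alpha_bar \<gamma> lam \<mu> n * lam n) *\<^sub>R (prev (x 0) z n - prev (x 0) p n)) \<and>
     (\<forall>n. (lam (Suc n) + \<mu> (Suc n)) *
            (theta_tilde bb \<gamma> lam \<mu> (Suc n) / theta_hat bb \<gamma> lam \<mu> (Suc n)
               * (norm_wrt M (u (Suc n)))\<^sup>2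
             + theta_hat bb \<gamma> lam \<mu> (Suc n) / theta bb \<gamma> lam \<mu> (Suc n)
               * (norm_wrt M (v (Suc n)))\<^sup>2)
          \<le> \<zeta> (Suc n) * ell M bb \<gamma> lam \<mu> x y z p u v n)"

end

theory Submission
  imports Defs
begin

text \<open>
  Everything rests on one exact identity. With \<open>\<mu>\<^sub>n = \<lambda>\<^sub>n\<^sup>2 / \<lambda>\<^sub>0 - \<lambda>\<^sub>n\<close> all parameters become multiples of
  \<open>S\<^sub>n = \<lambda>\<^sub>n + \<mu>\<^sub>n = \<lambda>\<^sub>n\<^sup>2 / \<lambda>\<^sub>0\<close>, and substituting the updates gives, without any inequality,
  for every point \<open>x\<^sup>*\<close>,
  \<open>\<parallel>x\<^bsub>n+1\<^esub> - x\<^sup>*\<parallel>\<^sup>2 + 2 \<gamma>\<^sub>n \<lambda>\<^sub>n \<phi>\<^sub>n + \<ell>\<^sub>n = \<parallel>x\<^sub>n - x\<^sup>*\<parallel>\<^sup>2 + 2 \<lambda>\<^sub>n \<gamma>\<^sub>n \<alpha>\<^sub>n \<phi>\<^bsub>n-1\<^esub> + d\<^sub>n\<close>,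
  where \<open>d\<^sub>n\<close> is the left-hand side of the safeguarding condition (\<open>one_step_identity\<close>; its
  algebraic content is \<open>energy_identity\<close>). The deviations \<open>u\<^sub>n\<close>, \<open>v\<^sub>n\<close> enter \<open>\<ell>\<^sub>n\<close> and the updates
  with exactly the weights for which all their cross terms with the other vectors cancel.

  Monotonicity of \<open>A\<close> and cocoercivity of \<open>C\<close> enter the descent only through signs: comparing the
  resolvent inclusion at step \<open>n\<close> with the one at \<open>x\<^sup>*\<close> gives \<open>\<phi>\<^sub>n \<ge> 0\<close>, and comparing it with the
  one at step \<open>n - 1\<close> gives that \<open>\<ell>\<^sub>n\<close> dominates its residual term. The safeguarding condition
  bounds \<open>d\<^sub>n\<close> by \<open>\<zeta>\<^sub>n \<ell>\<^bsub>n-1\<^esub>\<close> and the step-size condition makes the coefficient of \<open>\<phi>\<^sub>n\<close> drop by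
  at least \<open>2 \<epsilon>\<^sub>1\<close>. Hence \<open>V\<^bsub>n+1\<^esub> + 2 \<epsilon>\<^sub>1 \<phi>\<^sub>n + \<epsilon>\<^sub>0 \<ell>\<^bsub>n-1\<^esub> \<le> V\<^sub>n\<close> (\<open>lyapunov_descent\<close>), from which the
  convergence of \<open>V\<close>, the rate and the summability statements are read off.

  Weak convergence follows Opial's scheme. For bounded \<open>\<lambda>\<close> and positive \<open>\<epsilon>\<^sub>0\<close>, \<open>\<epsilon>\<^sub>1\<close> the descent
  shows that \<open>\<parallel>x\<^sub>n - x\<^sup>*\<parallel>\<close> converges for every zero \<open>x\<^sup>*\<close>, so two weak cluster points of \<open>p\<^sub>n\<close> that are
  zeros coincide as soon as \<open>p\<^sub>n - x\<^sub>n \<rightarrow> 0\<close>; for constant \<open>\<lambda>\<close> this and the other vanishing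
  differences are consequences of \<open>\<ell>\<^sub>n \<rightarrow> 0\<close>. Weak cluster points are zeros for the
  following reason: since the monotonicity gap vanishes, cocoercivity forces \<open>C y\<^sub>n \<rightarrow> C x\<^sup>*\<close>
  strongly, so the elements of \<open>A p\<^sub>n\<close> given by the resolvent step converge strongly, and the
  graph of \<open>A\<close> is closed under weak convergence of arguments and strong convergence of values.
  Cluster points are taken along filters below \<open>sequentially\<close> instead of subsequences, since
  their existence is then a direct consequence of Tychonoff's theorem and Riesz representation,
  also in non-separable spaces.
\<close>

section \<open>Strongly positive operators and their inner product\<close>

locale spd_operator =
  fixes M :: "'a::real_inner \<Rightarrow> 'a"
  assumes spd: "strongly_positive_op M"
begin

abbreviation ip :: "'a \<Rightarrow> 'a \<Rightarrow> real" where "ip \<equiv> inner_wrt M"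

lemma bounded_linear_M: "bounded_linear M"
  using spd by (simp add: strongly_positive_op_def)

lemma linear_M: "linear M"
  by (rule bounded_linear.linear[OF bounded_linear_M])

lemmas tendsto_M = bounded_linear.tendsto[OF bounded_linear_M]

lemma ip_commute: "ip a b = ip b a"
  using spd by (simp add: inner_wrt_def strongly_positive_op_def) (metis inner_commute)

lemma inner_M_left: "inner (M a) b = ip a b"
  using spd by (simp add: inner_wrt_def strongly_positive_op_def)

lemma ip_simps:
  "ip (a + b) c = ip a c + ip b c" "ip c (a + b) = ip c a + ip c b"
  "ip (a - b) c = ip a c - ip b c" "ip c (a - b) = ip c a - ip c b"
  "ip (t *\<^sub>R a) c = t * ip a c" "ip c (t *\<^sub>R a) = t * ip c a"
  "ip (- a) c = - ip a c" "ip c (- a) = - ip c a"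
  "ip 0 c = 0" "ip c 0 = 0"
  using linear_M
  unfolding inner_wrt_def
  by (simp_all add: linear_add linear_diff linear_cmul linear_neg linear_0 inner_simps)

lemma ip_coercive: obtains c where "c > 0" "\<And>a. c * (norm a)\<^sup>2 \<le> ip a a"
  using spd that unfolding strongly_positive_op_def inner_wrt_def by blast

lemma ip_nonneg: "0 \<le> ip a a"
proof -
  obtain c where c: "c > 0" "\<And>a. c * (norm a)\<^sup>2 \<le> ip a a"
    using ip_coercive by blast
  have "0 \<le> c * (norm a)\<^sup>2" using c(1) by simp
  also have "\<dots> \<le> ip a a" by (rule c)
  finally show ?thesis .
qed

lemma ip_self_eq_0: "ip a a = 0 \<longleftrightarrow> a = 0"
proof
  assume "ip a a = 0"
  obtain c where c: "c > 0" "\<And>a. c * (norm a)\<^sup>2 \<le> ip a a"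
    using ip_coercive by blast
  from c(2)[of a] \<open>ip a a = 0\<close> c(1) show "a = 0"
    by (simp add: mult_le_0_iff)
qed (simp add: ip_simps)

lemma norm_wrt_sq: "(norm_wrt M a)\<^sup>2 = ip a a"
  using ip_nonneg by (simp add: norm_wrt_def inner_wrt_def)

lemma tendsto_zero_of_ip:
  assumes "((\<lambda>n. ip (s n) (s n)) \<longlongrightarrow> 0) F"
  shows "(s \<longlongrightarrow> 0) F"
proof -
  obtain c where c: "c > 0" "\<And>a. c * (norm a)\<^sup>2 \<le> ip a a"
    using ip_coercive by blast
  have "((\<lambda>n. ip (s n) (s n) / c) \<longlongrightarrow> 0 / c) F"
    by (intro tendsto_intros assms) (use c in simp)
  then have "((\<lambda>n. ip (s n) (s n) / c) \<longlongrightarrow> 0) F" by simp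
  then have "((\<lambda>n. (norm (s n))\<^sup>2) \<longlongrightarrow> 0) F"
    by (rule Lim_null_comparison[rotated])
       (use c in \<open>auto simp: field_simps intro!: always_eventually\<close>)
  then have "((\<lambda>n. sqrt ((norm (s n))\<^sup>2)) \<longlongrightarrow> sqrt 0) F"
    by (intro tendsto_intros)
  then show ?thesis by (simp add: tendsto_norm_zero_iff)
qed

lemma bounded_of_ip:
  assumes "\<And>i. ip (s i) (s i) \<le> K"
  shows "bounded (range s)"
proof -
  obtain c where c: "c > 0" "\<And>a. c * (norm a)\<^sup>2 \<le> ip a a"
    using ip_coercive by blast
  have "norm (s i) \<le> sqrt (K / c)" for i
  proof -
    have "(norm (s i))\<^sup>2 \<le> K / c"
      using c(2)[of "s i"] assms[of i] c(1) by (simp add: field_simps)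
    then show ?thesis using real_le_rsqrt by blast
  qed
  then show ?thesis by (auto simp: bounded_iff)
qed

end

locale hilbert_spd_operator = spd_operator M
  for M :: "'a::{real_inner, complete_space} \<Rightarrow> 'a"
begin

text \<open>The minimiser of \<open>ip w w - 2 f w\<close> represents \<open>f\<close>; the parallelogram identity makes every
  minimising sequence Cauchy. Keeping a general \<open>M\<close> serves two purposes: \<open>M = id\<close> is Riesz
  representation, and \<open>f = inner b\<close> is the surjectivity of \<open>M\<close>, without which \<open>inv M\<close> would
  be meaningless.\<close>
lemma riesz:
  assumes "bounded_linear (f :: 'a \<Rightarrow> real)"
  obtains q where "\<And>w. ip q w = f w"
proof -
  interpret f: bounded_linear f by (rule assms)
  obtain c where c: "c > 0" "\<And>a. c * (norm a)\<^sup>2 \<le> ip a a"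
    using ip_coercive by blast
  obtain K where K: "\<And>w. norm (f w) \<le> norm w * K"
    using f.bounded by blast
  define J where "J w = ip w w - 2 * f w" for w
  have lower: "- (K\<^sup>2 / c) \<le> J w" for w
  proof -
    have "f w \<le> norm w * K" using K[of w] by simp
    moreover have "0 \<le> (c * norm w - K)\<^sup>2 / c" using c(1) by simp
    moreover have "(c * norm w - K)\<^sup>2 / c = c * (norm w)\<^sup>2 - 2 * (norm w * K) + K\<^sup>2 / c"
      using c(1) by (simp add: field_simps power2_eq_square)
    ultimately show ?thesis using c(2)[of w] by (simp add: J_def)
  qed
  define m where "m = (INF w. J w)"
  have bdd: "bdd_below (range J)" using lower by (intro bdd_belowI2)
  have m_le: "m \<le> J w" for w unfolding m_def by (rule cINF_lower[OF bdd]) simp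
  have "\<exists>w. J w < m + inverse (Suc n)" for n
    using cInf_lessD[of "range J" "m + inverse (Suc n)"] by (auto simp: m_def)
  then obtain s where s: "\<And>n. J (s n) < m + inverse (Suc n)" by metis
  have gap: "ip (a - b) (a - b) \<le> 2 * (J a + J b - 2 * m)" for a b
  proof -
    have "J ((1/2) *\<^sub>R (a + b)) = (J a + J b) / 2 - ip (a - b) (a - b) / 4"
      by (simp add: J_def ip_simps f.add f.scaleR ip_commute[of b a] field_simps)
    with m_le[of "(1/2) *\<^sub>R (a + b)"] show ?thesis by argo
  qed
  have "Cauchy s"
  proof (rule metric_CauchyI)
    fix e :: real assume "e > 0"
    then have "c * e\<^sup>2 / 4 > 0" using c by simp
    then obtain N where N: "inverse (Suc N) < c * e\<^sup>2 / 4"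
      using reals_Archimedean by blast
    have "dist (s i) (s j) < e" if "i \<ge> N" "j \<ge> N" for i j
    proof -
      have "inverse (real (Suc i)) \<le> inverse (real (Suc N))"
           "inverse (real (Suc j)) \<le> inverse (real (Suc N))"
        using that by (auto intro!: le_imp_inverse_le)
      then have "2 * (J (s i) + J (s j) - 2 * m) < c * e\<^sup>2"
        using s[of i] s[of j] N by argo
      with c(2)[of "s i - s j"] gap[of "s i" "s j"] have "c * (norm (s i - s j))\<^sup>2 < c * e\<^sup>2"
        by (meson order.strict_trans1)
      then show ?thesis
        using c(1) \<open>e > 0\<close> by (simp add: dist_norm power_less_imp_less_base)
    qed
    then show "\<exists>N. \<forall>i\<ge>N. \<forall>j\<ge>N. dist (s i) (s j) < e" by blast
  qed
  then obtain q where q: "s \<longlonglongrightarrow> q"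
    using Cauchy_convergent convergent_def by blast
  have "(\<lambda>n. J (s n)) \<longlonglongrightarrow> J q"
    unfolding J_def inner_wrt_def by (intro tendsto_intros q tendsto_M f.tendsto)
  moreover have "(\<lambda>n. m + inverse (real (Suc n))) \<longlonglongrightarrow> m + 0"
    by (intro tendsto_intros LIMSEQ_inverse_real_of_nat)
  ultimately have "J q \<le> m + 0"
    using s by (intro LIMSEQ_le) (auto intro: less_imp_le)
  then have q_min: "J q \<le> J w" for w using m_le[of w] by simp
  have "ip q w = f w" for w
  proof (rule ccontr)
    assume ne: "ip q w \<noteq> f w"
    define d where "d = ip q w - f w"
    \<comment> \<open>almost the minimiser of \<open>t \<mapsto> J (q + t w)\<close>; the summand 1 keeps the denominator positive for \<open>w = 0\<close>\<close>
    define t where "t = - d / (ip w w + 1)"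
    have pos: "ip w w + 1 > 0" using ip_nonneg[of w] by simp
    have "J (q + t *\<^sub>R w) - J q = 2 * t * d + t\<^sup>2 * ip w w"
      by (simp add: J_def d_def ip_simps f.add f.scaleR ip_commute[of w q] power2_eq_square algebra_simps)
    also have "\<dots> = 2 * t * d + t\<^sup>2 * (ip w w + 1) - t\<^sup>2" by (simp add: algebra_simps)
    also have "\<dots> = t * (2 * d + t * (ip w w + 1)) - t\<^sup>2"
      by (simp add: algebra_simps power2_eq_square)
    also have "\<dots> = - d\<^sup>2 / (ip w w + 1) - t\<^sup>2"
      using pos by (simp add: t_def power2_eq_square)
    also have "\<dots> < 0"
    proof -
      have "d\<^sup>2 > 0" using ne by (simp add: d_def)
      then have "d\<^sup>2 / (ip w w + 1) > 0" using pos by simp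
      moreover have "t\<^sup>2 \<ge> 0" by simp
      ultimately show ?thesis by linarith
    qed
    finally show False using q_min[of "q + t *\<^sub>R w"] by simp
  qed
  then show ?thesis by (rule that)
qed

lemma M_inv: "M (inv M b) = b"
proof -
  obtain q where "\<And>w. ip q w = inner b w"
    using riesz[of "inner b"] bounded_linear_inner_right by blast
  then have "inner (M q - b) w = 0" for w
    by (simp add: inner_diff_left inner_M_left)
  then have "M q = b" by (metis eq_iff_diff_eq_0 inner_eq_zero_iff)
  then show ?thesis by (metis f_inv_into_f rangeI)
qed

end

text \<open>
  The identity as \<open>M\<close>, which makes \<open>euclidean.riesz\<close> the classical Riesz representation theorem.
\<close>

section \<open>Weak cluster points in Hilbert spaces\<close>

interpretation euclidean: hilbert_spd_operator "\<lambda>a::'a::{real_inner, complete_space}. a"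
  by unfold_locales
     (auto simp: strongly_positive_op_def power2_norm_eq_inner intro: exI[of _ 1] bounded_linear_ident)

text \<open>Each functional \<open>inner (s n)\<close> lies in a product of compact intervals, one for every vector.
  A cluster point in this compact product is again linear and bounded, hence represented by
  a vector, and refining \<open>F\<close> by the neighbourhoods of the cluster point makes the convergence hold
  for all test vectors simultaneously.\<close>
lemma weak_cluster_point:
  fixes s :: "'i \<Rightarrow> 'a::{real_inner, complete_space}"
  assumes bd: "bounded (range s)" and F: "F \<noteq> bot"
  obtains G q where "G \<noteq> bot" "G \<le> F" "\<And>w. ((\<lambda>n. inner (s n) w) \<longlongrightarrow> inner q w) G"
proof -
  obtain B where B: "\<And>n. norm (s n) \<le> B" using bd by (auto simp: bounded_iff)
  have sw: "\<bar>inner (s n) w\<bar> \<le> B * norm w" for n w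
    using Cauchy_Schwarz_ineq2[of "s n" w] mult_right_mono[OF B[of n], of "norm w"] by simp
  define S where "S = (\<Pi>\<^sub>E w\<in>(UNIV::'a set). {- (B * norm w)..B * norm w})"
  define g where "g n = (\<lambda>w. inner (s n) w)" for n
  have "compactin (product_topology (\<lambda>w::'a. euclidean :: real topology) UNIV) S"
    unfolding S_def compactin_PiE by simp
  then have "compact S" by (simp add: euclidean_product_topology)
  moreover have "filtermap g F \<noteq> bot" using F by (simp add: filtermap_bot_iff)
  moreover have "eventually (\<lambda>h. h \<in> S) (filtermap g F)"
    using sw by (auto simp: eventually_filtermap S_def g_def abs_le_iff intro!: always_eventually)
       (metis minus_le_iff)
  ultimately obtain h where "inf (nhds h) (filtermap g F) \<noteq> bot"
    by (auto simp: compact_filter)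
  define G where "G = inf (filtercomap g (nhds h)) F"
  have "G \<noteq> bot"
  proof
    assume "G = bot"
    then have "eventually (\<lambda>_. False) G" by simp
    then obtain P Q where PQ: "eventually P (filtercomap g (nhds h))" "eventually Q F"
        "\<And>n. P n \<Longrightarrow> Q n \<Longrightarrow> False"
      unfolding G_def eventually_inf by blast
    then obtain R where R: "eventually R (nhds h)" "\<And>n. R (g n) \<Longrightarrow> P n"
      unfolding eventually_filtercomap by blast
    have "eventually (\<lambda>k. \<not> R k) (filtermap g F)"
      unfolding eventually_filtermap using PQ(2) by eventually_elim (use PQ(3) R(2) in blast)
    with R(1) have "eventually (\<lambda>_. False) (inf (nhds h) (filtermap g F))"
      unfolding eventually_inf by blast
    with \<open>inf (nhds h) (filtermap g F) \<noteq> bot\<close> show False by (simp add: trivial_limit_def)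
  qed
  have "filterlim g (nhds h) G"
    unfolding filterlim_def G_def
    by (rule order_trans[OF filtermap_mono[OF inf_le1] filtermap_filtercomap])
  then have lim: "((\<lambda>n. inner (s n) w) \<longlongrightarrow> h w) G" for w
    using continuous_on_tendsto_compose[OF continuous_on_product_coordinates[of w], of g h G]
    by (simp add: g_def)
  have "bounded_linear h"
  proof (rule bounded_linear_intro)
    show "h (a + b) = h a + h b" for a b
      using tendsto_unique[OF \<open>G \<noteq> bot\<close> lim[of "a + b"]] tendsto_add[OF lim[of a] lim[of b]]
      by (simp add: inner_add_right)
    show "h (t *\<^sub>R a) = t *\<^sub>R h a" for t a
      using tendsto_unique[OF \<open>G \<noteq> bot\<close> lim[of "t *\<^sub>R a"]] tendsto_mult_left[OF lim[of a], of t]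
      by simp
    show "norm (h a) \<le> norm a * B" for a
    proof -
      have "((\<lambda>n. \<bar>inner (s n) a\<bar>) \<longlongrightarrow> \<bar>h a\<bar>) G" by (intro tendsto_intros lim)
      then have "\<bar>h a\<bar> \<le> B * norm a"
        by (rule tendsto_upperbound) (use sw \<open>G \<noteq> bot\<close> in \<open>auto intro: always_eventually\<close>)
      then show ?thesis by (simp add: mult.commute)
    qed
  qed
  then obtain q where "\<And>w. inner q w = h w"
    using euclidean.riesz[of h] by (auto simp: inner_wrt_def)
  then show ?thesis using that[of G q] \<open>G \<noteq> bot\<close> lim by (simp add: G_def)
qed

text \<open>If convergence failed for one test vector, the indices where the inner product stays away
  from its candidate limit would carry a filter with a second cluster point.\<close>
lemma weakly_convergent_if_unique_cluster_point:
  fixes s :: "nat \<Rightarrow> 'a::{real_inner, complete_space}"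
  assumes bd: "bounded (range s)"
    and cluster: "\<And>G q. \<lbrakk>G \<noteq> bot; G \<le> sequentially; \<And>w. ((\<lambda>n. inner (s n) w) \<longlongrightarrow> inner q w) G\<rbrakk> \<Longrightarrow> q \<in> Z"
    and unique: "\<And>G G' q q'. \<lbrakk>G \<noteq> bot; G \<le> sequentially; \<And>w. ((\<lambda>n. inner (s n) w) \<longlongrightarrow> inner q w) G;
                G' \<noteq> bot; G' \<le> sequentially; \<And>w. ((\<lambda>n. inner (s n) w) \<longlongrightarrow> inner q' w) G'\<rbrakk> \<Longrightarrow> q = q'"
  shows "\<exists>q\<in>Z. weakly_convergent_to s q"
proof -
  obtain G q where G: "G \<noteq> bot" "G \<le> sequentially" "\<And>w. ((\<lambda>n. inner (s n) w) \<longlongrightarrow> inner q w) G"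
    using weak_cluster_point[OF bd, of sequentially] by auto
  have "(\<lambda>n. inner (s n) w) \<longlonglongrightarrow> inner q w" for w
  proof (rule ccontr)
    assume "\<not> (\<lambda>n. inner (s n) w) \<longlonglongrightarrow> inner q w"
    then obtain e where e: "e > 0" "\<not> eventually (\<lambda>n. dist (inner (s n) w) (inner q w) < e) sequentially"
      by (auto simp: tendsto_iff)
    define F where "F = inf sequentially (principal {n. \<not> dist (inner (s n) w) (inner q w) < e})"
    have "F \<noteq> bot"
      using e(2) by (auto simp: F_def trivial_limit_def eventually_inf_principal)
    then obtain H q' where H: "H \<noteq> bot" "H \<le> F" "\<And>w. ((\<lambda>n. inner (s n) w) \<longlongrightarrow> inner q' w) H"
      using weak_cluster_point[OF bd] by blast
    have "H \<le> sequentially" using H(2) by (simp add: F_def)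
    then have "q = q'" by (rule unique[OF G H(1) _ H(3)])
    then have "eventually (\<lambda>n. dist (inner (s n) w) (inner q w) < e) H"
      using H(3)[of w] e(1) by (simp add: tendsto_iff)
    moreover have "eventually (\<lambda>n. \<not> dist (inner (s n) w) (inner q w) < e) H"
      by (rule filter_leD[OF H(2)]) (simp add: F_def eventually_inf_principal)
    ultimately have "eventually (\<lambda>_. False) H" by eventually_elim simp
    with H(1) show False by (simp add: trivial_limit_def)
  qed
  then show ?thesis using cluster[OF G] by (auto simp: weakly_convergent_to_def)
qed

section \<open>Cocoercive and maximally monotone operators\<close>

context hilbert_spd_operator begin

text \<open>Writing \<open>C a - C b = M e\<close> turns the dual norm of \<open>C a - C b\<close> into the primal norm of \<open>e\<close>,
  so that everything can be expanded with \<open>ip\<close>.\<close>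
lemma cocoerciveD:
  assumes "cocoercive_wrt M \<beta> C"
  shows "ip (inv M (C a - C b)) (inv M (C a - C b)) \<le> \<beta> * inner (C a - C b) (a - b)"
proof -
  define e where "e = inv M (C a - C b)"
  have "inner (C a - C b) e = ip e e"
    using inner_M_left[of e e] by (simp add: e_def M_inv)
  then have "(norm_wrt (inv M) (C a - C b))\<^sup>2 = ip e e"
    using ip_nonneg[of e] by (simp add: norm_wrt_def e_def)
  then show ?thesis
    using assms unfolding cocoercive_wrt_def e_def by metis
qed

lemma inner_eq_ip_inv: "inner c d = ip (inv M c) d"
  using inner_M_left[of "inv M c" d] by (simp add: M_inv)

text \<open>The inequality behind both sign conditions: the points at which \<open>C\<close> is evaluated are not
  those at which \<open>A\<close> is, and completing the square shows that a mismatch \<open>f = d - (a - b)\<close> costs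
  at most \<open>\<beta>/4\<close> times its squared norm.\<close>
lemma cocoercive_slack:
  assumes C: "cocoercive_wrt M \<beta> C" and \<beta>: "0 \<le> \<beta>"
  shows "- (\<beta> / 4 * ip (d - (a - b)) (d - (a - b))) \<le> inner (C a - C b) d"
proof -
  define e where "e = inv M (C a - C b)"
  define f where "f = d - (a - b)"
  have coc: "ip e e \<le> \<beta> * ip e (d - f)"
    using cocoerciveD[OF C, of a b] by (simp add: e_def f_def inner_eq_ip_inv)
  show ?thesis
  proof (cases "\<beta> = 0")
    case True
    then have "e = 0" using coc ip_nonneg[of e] ip_self_eq_0[of e] by simp
    then show ?thesis using True by (simp add: inner_eq_ip_inv e_def[symmetric] ip_simps)
  next
    case False
    have "0 \<le> ip (2 *\<^sub>R e + \<beta> *\<^sub>R f) (2 *\<^sub>R e + \<beta> *\<^sub>R f)" by (rule ip_nonneg)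
    also have "\<dots> = 4 * ip e e + 4 * \<beta> * ip e f + \<beta>\<^sup>2 * ip f f"
      by (simp add: ip_simps ip_commute[of f e] power2_eq_square algebra_simps)
    also have "\<dots> \<le> 4 * \<beta> * ip e d + \<beta>\<^sup>2 * ip f f"
      using coc by (simp add: ip_simps algebra_simps)
    finally have "0 \<le> \<beta> * (4 * ip e d + \<beta> * ip f f)"
      by (simp add: power2_eq_square algebra_simps)
    then have "0 \<le> 4 * ip e d + \<beta> * ip f f"
      using False \<beta> by (simp add: zero_le_mult_iff)
    then show ?thesis by (simp add: inner_eq_ip_inv e_def f_def)
  qed
qed

text \<open>In contrast to \<open>cocoercive_slack\<close>, half of the dual norm is kept here, which yields strong
  convergence of the values of \<open>C\<close> once both terms on the right vanish.\<close>
lemma cocoercive_dual_bound: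
  assumes C: "cocoercive_wrt M \<beta> C"
  shows "ip (inv M (C a - C b)) (inv M (C a - C b))
    \<le> 2 * \<beta> * inner (C a - C b) d + \<beta>\<^sup>2 * ip (d - (a - b)) (d - (a - b))"
proof -
  define e where "e = inv M (C a - C b)"
  define f where "f = d - (a - b)"
  have coc: "ip e e \<le> \<beta> * ip e (d - f)"
    using cocoerciveD[OF C, of a b] by (simp add: e_def f_def inner_eq_ip_inv)
  \<comment> \<open>Young's inequality for \<open>ip e f\<close> in the form that leaves half of \<open>ip e e\<close>\<close>
  have "0 \<le> ip (e + \<beta> *\<^sub>R f) (e + \<beta> *\<^sub>R f)" by (rule ip_nonneg)
  also have "\<dots> = ip e e + 2 * \<beta> * ip e f + \<beta>\<^sup>2 * ip f f"
    by (simp add: ip_simps ip_commute[of f e] power2_eq_square algebra_simps)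
  finally have "ip e e \<le> 2 * \<beta> * ip e d + \<beta>\<^sup>2 * ip f f"
    using coc unfolding ip_simps right_diff_distrib by linarith
  then show ?thesis by (simp add: inner_eq_ip_inv e_def f_def)
qed

lemma tendsto_of_dual_ip:
  assumes "((\<lambda>n. ip (inv M (s n - c)) (inv M (s n - c))) \<longlongrightarrow> 0) F"
  shows "(s \<longlongrightarrow> c) F"
proof -
  have "((\<lambda>n. M (inv M (s n - c))) \<longlongrightarrow> M 0) F"
    by (rule tendsto_M[OF tendsto_zero_of_ip[OF assms]])
  then show ?thesis
    using linear_0[OF linear_M] by (simp add: M_inv LIM_zero_cancel)
qed

end

text \<open>Otherwise adjoining \<open>(q, a)\<close> to the graph of \<open>A\<close> would give a proper monotone extension.\<close>
lemma maximally_monotone_memI: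
  assumes A: "maximally_monotone A"
    and mono: "\<And>r b. b \<in> A r \<Longrightarrow> 0 \<le> inner (b - a) (r - q)"
  shows "a \<in> A q"
proof -
  define B where "B = A(q := insert a (A q))"
  have "monotone_op B"
  proof -
    have "monotone_op A" using A by (simp add: maximally_monotone_def)
    moreover have "0 \<le> inner (a - b) (q - r)" if "b \<in> A r" for b r
      using mono[OF that] by (metis inner_minus_left inner_minus_right minus_diff_eq minus_minus)
    ultimately show ?thesis
      using mono unfolding monotone_op_def B_def by (auto split: if_splits)
  qed
  moreover have "\<forall>r. A r \<subseteq> B r" by (auto simp: B_def)
  ultimately have "B = A" using A unfolding maximally_monotone_def by blast
  then show ?thesis by (metis B_def fun_upd_same insertI1)
qed

lemma tendsto_inner_bounded_null:
  fixes s t :: "'i \<Rightarrow> 'a::real_inner"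
  assumes bd: "bounded (range s)" and t: "(t \<longlongrightarrow> 0) F"
  shows "((\<lambda>n. inner (s n) (t n)) \<longlongrightarrow> 0) F"
proof -
  obtain B where B: "\<And>n. norm (s n) \<le> B" using bd by (auto simp: bounded_iff)
  have "((\<lambda>n. B * norm (t n)) \<longlongrightarrow> 0) F"
    using tendsto_mult_left[OF tendsto_norm_zero[OF t], of B] by simp
  then show ?thesis
    by (rule Lim_null_comparison[rotated])
       (use B in \<open>auto intro!: always_eventually order_trans[OF Cauchy_Schwarz_ineq2] mult_right_mono\<close>)
qed

lemma tendsto_inner_weak_strong:
  fixes s t :: "'i \<Rightarrow> 'a::real_inner"
  assumes bd: "bounded (range s)"
    and weak: "\<And>w. ((\<lambda>n. inner (s n) w) \<longlongrightarrow> inner q w) F"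
    and strong: "(t \<longlongrightarrow> c) F"
  shows "((\<lambda>n. inner (s n) (t n)) \<longlongrightarrow> inner q c) F"
  using tendsto_add[OF tendsto_inner_bounded_null[OF bd LIM_zero[OF strong]] weak[of c]]
  by (simp add: inner_diff_right)

lemma tendsto_zero_scaleR_bounded:
  fixes s :: "'i \<Rightarrow> 'a::real_normed_vector"
  assumes s: "(s \<longlongrightarrow> 0) F" and c: "\<And>n. \<bar>c n\<bar> \<le> K"
  shows "((\<lambda>n. c n *\<^sub>R s n) \<longlongrightarrow> 0) F"
proof (rule Lim_null_comparison)
  show "((\<lambda>n. K * norm (s n)) \<longlongrightarrow> 0) F"
    using tendsto_mult_left[OF tendsto_norm_zero[OF s], of K] by simp
  show "\<forall>\<^sub>F n in F. norm (c n *\<^sub>R s n) \<le> K * norm (s n)"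
    using c by (auto intro!: always_eventually mult_right_mono)
qed

lemma summable_of_descent:
  fixes f V :: "nat \<Rightarrow> real"
  assumes "\<And>n. 0 \<le> f n" and V: "\<And>n. 0 \<le> V n" and step: "\<And>n. V (Suc n) + f n \<le> V n"
  shows "summable f"
proof (rule summableI_nonneg_bounded)
  fix n
  have "sum f {..<n} + V n \<le> V 0"
  proof (induction n)
    case (Suc n)
    with step[of n] show ?case by simp
  qed simp
  with V[of n] show "sum f {..<n} \<le> V 0" by linarith
qed (rule assms(1))

lemma maximally_monotone_demiclosed:
  assumes A: "maximally_monotone A" and G: "G \<noteq> bot"
    and mem: "\<And>n. a n \<in> A (s n)" and bd: "bounded (range s)"
    and weak: "\<And>w. ((\<lambda>n. inner (s n) w) \<longlongrightarrow> inner q w) G"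
    and strong: "(a \<longlongrightarrow> c) G"
  shows "c \<in> A q"
proof (rule maximally_monotone_memI[OF A])
  fix r b assume "b \<in> A r"
  then have nn: "0 \<le> inner (b - a n) (r - s n)" for n
    using A mem unfolding maximally_monotone_def monotone_op_def by blast
  have "((\<lambda>n. inner (b - a n) r - inner (s n) (b - a n)) \<longlongrightarrow> inner (b - c) r - inner q (b - c)) G"
    by (intro tendsto_intros strong tendsto_inner_weak_strong[OF bd weak])
  then have "((\<lambda>n. inner (b - a n) (r - s n)) \<longlongrightarrow> inner (b - c) (r - q)) G"
    by (simp add: inner_diff_right inner_commute)
  then show "0 \<le> inner (b - c) (r - q)"
    by (rule tendsto_lowerbound) (use nn G in \<open>auto intro: always_eventually\<close>)
qed

section \<open>The algebraic energy identity\<close>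

context spd_operator begin

text \<open>The part of the one-step identity that involves the deviations, divided by \<open>S\<^sub>n\<close>. The
  coefficients of \<open>u\<close> and \<open>v\<close> in \<open>E\<close> and \<open>R\<close> are the ones for which the mixed
  products of \<open>D\<close>, \<open>u\<close> and \<open>v\<close> disappear.\<close>
lemma completed_square_identity:
  fixes b L :: real
  defines "N \<equiv> 2 - b * L" and "T \<equiv> 4 - b - 2 * L"
  assumes N: "N \<noteq> 0" and T: "T \<noteq> 0"
    and E: "E = ((1 - L) * b / N) *\<^sub>R u + v - D"
    and R: "R = D + (b * L / N) *\<^sub>R u - (2 * (1 - L) / T) *\<^sub>R v"
  shows "L * ip E E + 2 * ip E D + b / 2 * ip (u - D) (u - D) + T / 2 * ip R R
    = b / N * ip u u + N / T * ip v v"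
proof -
  define k where "k = (1 - L) * b / N"
  define g where "g = b * L / N"
  define h where "h = 2 * (1 - L) / T"
  have Nk: "N * k = (1 - L) * b" and Ng: "N * g = b * L" and Th: "T * h = 2 * (1 - L)"
    using N T by (simp_all add: k_def g_def h_def)
  \<comment> \<open>the coefficients of the six inner products, each checked after clearing its denominators\<close>
  have DD: "L - 2 + b / 2 + T / 2 = 0" by (simp add: T_def field_simps)
  have uD: "2 * k * (1 - L) - b + T * g = 0"
  proof -
    have "N * (2 * k * (1 - L) - b + T * g) = 2 * (1 - L) * (N * k) - N * b + T * (N * g)"
      by (simp add: algebra_simps)
    also have "\<dots> = 0" unfolding Nk Ng by (simp add: N_def T_def algebra_simps)
    finally show ?thesis using N by simp
  qed
  have vD: "2 * (1 - L) - T * h = 0" by (simp add: Th)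
  have uu: "L * k\<^sup>2 + b / 2 + T / 2 * g\<^sup>2 = b / N"
  proof -
    have "N\<^sup>2 * (L * k\<^sup>2 + b / 2 + T / 2 * g\<^sup>2) = L * (N * k)\<^sup>2 + b * N\<^sup>2 / 2 + T / 2 * (N * g)\<^sup>2"
      by (simp add: algebra_simps power2_eq_square)
    also have "\<dots> = N * b" unfolding Nk Ng
      by (simp add: N_def T_def field_simps power2_eq_square)
    finally have "N * (L * k\<^sup>2 + b / 2 + T / 2 * g\<^sup>2) = b"
      using N unfolding power2_eq_square mult.assoc mult_cancel_left by blast
    then show ?thesis using N by (metis nonzero_mult_div_cancel_left)
  qed
  have uv: "2 * L * k - T * g * h = 0"
  proof -
    have "N * (2 * L * k - T * g * h) = 2 * L * (N * k) - (N * g) * (T * h)"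
      by (simp add: algebra_simps)
    also have "\<dots> = 0" unfolding Nk Ng Th by (simp add: algebra_simps)
    finally show ?thesis using N by simp
  qed
  have vv: "L + T / 2 * h\<^sup>2 = N / T"
  proof -
    have "T * (L + T / 2 * h\<^sup>2) = L * T + (T * h)\<^sup>2 / 2"
      by (simp add: algebra_simps power2_eq_square)
    also have "\<dots> = N" unfolding Th by (simp add: N_def T_def field_simps power2_eq_square)
    finally show ?thesis using T by (simp add: field_simps)
  qed
  have "L * ip E E + 2 * ip E D + b / 2 * ip (u - D) (u - D) + T / 2 * ip R R
    = (L - 2 + b / 2 + T / 2) * ip D D + (2 * k * (1 - L) - b + T * g) * ip u D
      + (2 * (1 - L) - T * h) * ip v D + (L * k\<^sup>2 + b / 2 + T / 2 * g\<^sup>2) * ip u u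
      + (2 * L * k - T * g * h) * ip u v + (L + T / 2 * h\<^sup>2) * ip v v"
    unfolding E R k_def[symmetric] g_def[symmetric] h_def[symmetric]
    by (simp add: ip_simps ip_commute[of D u] ip_commute[of D v] ip_commute[of v u] power2_eq_square field_simps)
  also have "\<dots> = b / N * ip u u + N / T * ip v v"
    unfolding DD uD vD uu uv vv by simp
  finally show ?thesis .
qed

text \<open>The dictionary is \<open>X = x\<^sub>n - x\<^sup>*\<close>, \<open>P = p\<^sub>n - x\<^sup>*\<close>, \<open>P' = p\<^bsub>n-1\<^esub> - x\<^sup>*\<close>, \<open>w = z\<^bsub>n-1\<^esub> - p\<^bsub>n-1\<^esub>\<close>,
  \<open>q = y\<^bsub>n-1\<^esub> - p\<^bsub>n-1\<^esub>\<close>, \<open>zp = z\<^sub>n - p\<^sub>n\<close>, \<open>yp = y\<^sub>n - p\<^sub>n\<close>, \<open>a = \<alpha>\<^sub>n\<close>, \<open>b = \<gamma>\<^sub>n \<beta>\<close> with the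
  barred \<open>\<beta>\<close>, \<open>r = \<gamma>\<^sub>n / \<gamma>\<^bsub>n-1\<^esub>\<close>, \<open>L = \<lambda>\<^sub>0\<close> and \<open>lm = \<lambda>\<^sub>n\<close>. The history vectors \<open>w\<close> and \<open>q\<close>
  separate from the rest because \<open>\<lambda>\<^sub>n = S (1 - a)\<close> and \<open>\<mu>\<^sub>n = S a\<close>: for instance
  \<open>(1 - a) \<parallel>G + a q\<parallel>\<^sup>2 + a \<parallel>G - (1 - a) q\<parallel>\<^sup>2 = \<parallel>G\<parallel>\<^sup>2 + a (1 - a) \<parallel>q\<parallel>\<^sup>2\<close>. What remains is
  \<open>completed_square_identity\<close>.\<close>
lemma energy_identity:
  fixes a b L S r :: real
  defines "N \<equiv> 2 - b * L" and "T \<equiv> 4 - b - 2 * L" and "lm \<equiv> S * (1 - a)"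
  assumes N: "N \<noteq> 0" and T: "T \<noteq> 0" and lm: "lm\<^sup>2 = S * L"
    and D: "D = P - (1 - a) *\<^sub>R X - a *\<^sub>R P'"
    and E: "E = ((1 - L) * b / N) *\<^sub>R u + v - D"
    and R: "R = D + (b * L / N) *\<^sub>R u - (2 * (1 - L) / T) *\<^sub>R v"
    and zp: "zp = (a * r) *\<^sub>R w + E"
    and yp: "yp = u - D + a *\<^sub>R q"
  shows "ip (X - lm *\<^sub>R E) (X - lm *\<^sub>R E) + (2 * lm * ip zp P + lm * b / 2 * ip yp yp)
      + (S * T / 2 * ip R R + 2 * (S * a) * ip (zp - r *\<^sub>R w) (P - P')
         + S * a * b / 2 * ip (q - yp) (q - yp))
    = ip X X + lm * a * (2 * r * ip w P' + b / 2 * ip q q)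
      + S * (b / N * ip u u + N / T * ip v v)"
proof -
  have core: "S * (L * ip E E + 2 * ip E D + b / 2 * ip (u - D) (u - D) + T / 2 * ip R R)
      = S * (b / N * ip u u + N / T * ip v v)"
    using completed_square_identity[of b L E u v D R] N T E R
    by (simp add: N_def T_def)
  have y_part: "lm * ip yp yp + S * a * ip (q - yp) (q - yp)
      = S * ip (u - D) (u - D) + lm * a * ip q q"
  proof -
    define G where "G = u - D"
    show ?thesis unfolding yp G_def[symmetric] lm_def
      by (simp add: ip_simps ip_commute[of q G] algebra_simps)
  qed
  have z_part: "lm * ip zp P + S * a * ip (zp - r *\<^sub>R w) (P - P')
      = lm * a * r * ip w P' + S * ip E (P - a *\<^sub>R P')"
    unfolding zp lm_def by (simp add: ip_simps algebra_simps)
  have "S * ip E (P - a *\<^sub>R P') = S * ip E D + lm * ip E X"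
    unfolding lm_def D by (simp add: ip_simps algebra_simps)
  moreover have "ip (X - lm *\<^sub>R E) (X - lm *\<^sub>R E) = ip X X - 2 * lm * ip E X + S * L * ip E E"
    unfolding lm[symmetric] by (simp add: ip_simps ip_commute[of X E] power2_eq_square algebra_simps)
  moreover have "b / 2 * (lm * ip yp yp + S * a * ip (q - yp) (q - yp))
      = b / 2 * (S * ip (u - D) (u - D) + lm * a * ip q q)"
    by (simp only: y_part)
  ultimately show ?thesis
    using core z_part by (simp add: algebra_simps)
qed

end

section \<open>Runs of the algorithm\<close>

lemma prev_simps [simp]: "prev c f 0 = c" "prev c f (Suc n) = f n"
  by (simp_all add: prev_def)

locale forward_backward_run = hilbert_spd_operator M
  for M :: "'a::{real_inner, complete_space} \<Rightarrow> 'a" +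
  fixes A :: "'a \<Rightarrow> 'a set" and C :: "'a \<Rightarrow> 'a"
    and \<beta> bb eps eps0 eps1 :: real
    and \<gamma> lam \<mu> \<zeta> :: "nat \<Rightarrow> real"
    and x y z p u v :: "nat \<Rightarrow> 'a"
  assumes maximal: "maximally_monotone A"
    and cocoercive: "cocoercive_wrt M \<beta> C"
    and beta_nonneg: "0 \<le> \<beta>" and beta_le: "\<beta> \<le> bb"
    and eps_pos: "0 < eps" and eps0_nonneg: "0 \<le> eps0" and eps1_nonneg: "0 \<le> eps1"
    and gamma_pos: "\<And>n. 0 < \<gamma> n" and lam_pos: "\<And>n. 0 < lam n"
    and mu_eq: "\<And>n. \<mu> n = (1 / lam 0) * (lam n)\<^sup>2 - lam n"
    and zeta_bounds: "\<And>n. 0 \<le> \<zeta> n \<and> \<zeta> n \<le> 1 - eps0"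
    and gamma_bounds: "\<And>n. eps \<le> \<gamma> n * bb \<and> \<gamma> n * bb \<le> 4 - 2 * lam 0 - eps"
    and lam_step: "\<And>n. lam n \<le> lam (Suc n)"
    and gamma_lam_step:
      "\<And>n. \<gamma> (Suc n) * lam (Suc n) - \<gamma> n * lam n \<le> \<gamma> (Suc n) * lam 0 - eps1"
    and run: "algorithm_run M A C bb \<gamma> lam \<mu> \<zeta> x y z p u v"
begin

text \<open>The normalised parameters: \<open>\<theta>\<^sub>n = S\<^sub>n T\<^sub>n\<close> and its hatted variant is \<open>S\<^sub>n N\<^sub>n\<close>.\<close>
abbreviation "b n \<equiv> \<gamma> n * bb"
abbreviation "S n \<equiv> (lam n)\<^sup>2 / lam 0"
abbreviation "N n \<equiv> 2 - b n * lam 0"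
abbreviation "T n \<equiv> 4 - b n - 2 * lam 0"

abbreviation "res n \<equiv> residual bb \<gamma> lam \<mu> x p u v n"
text \<open>This is \<open>\<ell>\<^sub>n\<close>; the Lyapunov function loses a multiple \<open>1 - \<zeta>\<^bsub>n+1\<^esub>\<close> of it in step \<open>n + 1\<close>.\<close>
abbreviation "decrease n \<equiv> ell M bb \<gamma> lam \<mu> x y z p u v n"

text \<open>This is \<open>\<phi>\<^sub>n\<close>, a substitute for the monotonicity gap of \<open>A + C\<close> between \<open>p\<^sub>n\<close> and the reference
  point: the quadratic term compensates for evaluating \<open>C\<close> at \<open>y\<^sub>n\<close> instead of \<open>p\<^sub>n\<close>.\<close>
definition gap :: "'a \<Rightarrow> nat \<Rightarrow> real" where
  "gap xs n = ip ((1 / \<gamma> n) *\<^sub>R (z n - p n)) (p n - xs) + bb / 4 * ip (y n - p n) (y n - p n)"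

text \<open>With previous values \<open>0\<close> at index \<open>0\<close>, the first value \<open>V\<^sub>0\<close> follows the same formula as the others.\<close>
definition lyapunov :: "'a \<Rightarrow> nat \<Rightarrow> real" where
  "lyapunov xs n = ip (x n - xs) (x n - xs)
     + 2 * lam n * \<gamma> n * alpha lam \<mu> n * prev 0 (gap xs) n + prev 0 decrease n"

lemma lam_ge: "lam 0 \<le> lam n"
  by (induction n) (use lam_step order_trans in blast)+

lemma bb_pos: "0 < bb"
  using gamma_bounds[of 0] eps_pos gamma_pos[of 0]
  by (metis less_le_trans zero_less_mult_pos)

lemma b_bounds: "eps \<le> b n" "0 < b n" "b n \<le> 4"
  using gamma_bounds[of n] eps_pos lam_pos[of 0] by linarith+

lemma S_pos: "0 < S n"
  using lam_pos[of n] lam_pos[of 0] by simp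

lemma T_bounds: "eps \<le> T n" "0 < T n" "T n \<le> 4"
  using gamma_bounds[of n] eps_pos lam_pos[of 0] by linarith+

text \<open>Positivity for all admissible \<open>\<lambda>\<^sub>0\<close> comes from
  \<open>2 - (4 - 2 L) L = 2 (1 - L)\<^sup>2\<close> with \<open>L = \<lambda>\<^sub>0\<close>.\<close>
lemma N_bounds: "eps * lam 0 \<le> N n" "0 < N n" "N n \<le> 2"
proof -
  have "b n * lam 0 \<le> (4 - 2 * lam 0 - eps) * lam 0"
    using gamma_bounds[of n] lam_pos[of 0] by (intro mult_right_mono) auto
  moreover have "2 - (4 - 2 * lam 0 - eps) * lam 0 = 2 * (1 - lam 0)\<^sup>2 + eps * lam 0"
    by (simp add: power2_eq_square algebra_simps)
  moreover have "0 \<le> 2 * (1 - lam 0)\<^sup>2" by simp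
  ultimately show 1: "eps * lam 0 \<le> N n" by linarith
  have "0 < eps * lam 0" using eps_pos lam_pos by simp
  with 1 show "0 < N n" by linarith
  have "0 < b n * lam 0" using b_bounds[of n] lam_pos by simp
  then show "N n \<le> 2" by linarith
qed

lemma lam_plus_mu: "lam n + \<mu> n = S n"
  by (simp add: mu_eq)

lemma alpha_eq: "alpha lam \<mu> n = 1 - lam 0 / lam n"
  using lam_pos[of n] lam_pos[of 0]
  by (simp add: alpha_def lam_plus_mu mu_eq field_simps power2_eq_square)

lemma lam_eq: "lam n = S n * (1 - alpha lam \<mu> n)"
  using lam_pos[of n] lam_pos[of 0] by (simp add: alpha_eq power2_eq_square)

lemma mu_eq_alpha: "\<mu> n = S n * alpha lam \<mu> n"
  using lam_plus_mu[of n] lam_eq[of n] unfolding right_diff_distrib by linarith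

lemma alpha_bar_eq: "alpha_bar \<gamma> lam \<mu> n = alpha lam \<mu> n * (\<gamma> n / prev (\<gamma> 0) \<gamma> n)"
  by (simp add: alpha_bar_def alpha_def ac_simps)

lemma theta_eqs:
  "theta bb \<gamma> lam \<mu> n = S n * T n"
  "theta_hat bb \<gamma> lam \<mu> n = S n * N n"
  "theta_bar lam \<mu> n = S n * (1 - lam 0)"
  "theta_tilde bb \<gamma> lam \<mu> n = S n * b n"
proof -
  define s where "s = S n"
  have sq: "(lam n)\<^sup>2 = s * lam 0" using lam_pos[of 0] by (simp add: s_def)
  have sum: "lam n + \<mu> n = s" by (simp add: lam_plus_mu s_def)
  then have sum2: "2 * lam n + 2 * \<mu> n = 2 * s" by simp
  show "theta bb \<gamma> lam \<mu> n = S n * T n"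
    "theta_hat bb \<gamma> lam \<mu> n = S n * N n"
    "theta_bar lam \<mu> n = S n * (1 - lam 0)"
    unfolding s_def[symmetric] theta_def theta_hat_def theta_bar_def sum2 sum sq
    using lam_pos[of 0] by (simp_all add: algebra_simps)
  show "theta_tilde bb \<gamma> lam \<mu> n = S n * b n"
    by (simp add: theta_tilde_def lam_plus_mu)
qed

text \<open>The common factor \<open>S\<^sub>n\<close> cancels, so these coefficients depend on \<open>n\<close> only through
  \<open>\<gamma>\<^sub>n\<close> and stay bounded even if \<open>\<lambda>\<^sub>n\<close> does not.\<close>
lemma coefficient_eqs:
  "b n * (lam n)\<^sup>2 / theta_hat bb \<gamma> lam \<mu> n = b n * lam 0 / N n"
  "2 * theta_bar lam \<mu> n / theta bb \<gamma> lam \<mu> n = 2 * (1 - lam 0) / T n"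
  "theta_bar lam \<mu> n * \<gamma> n * bb / theta_hat bb \<gamma> lam \<mu> n = (1 - lam 0) * b n / N n"
  "theta_tilde bb \<gamma> lam \<mu> n / theta_hat bb \<gamma> lam \<mu> n = b n / N n"
  "theta_hat bb \<gamma> lam \<mu> n / theta bb \<gamma> lam \<mu> n = N n / T n"
proof -
  have S: "S n \<noteq> 0" and sq: "(lam n)\<^sup>2 = S n * lam 0"
    using S_pos[of n] lam_pos[of 0] by auto
  show "b n * (lam n)\<^sup>2 / theta_hat bb \<gamma> lam \<mu> n = b n * lam 0 / N n"
    unfolding theta_eqs
    using mult_divide_mult_cancel_left[OF S, of "b n * lam 0" "N n"] lam_pos[of n] lam_pos[of 0]
    by (simp add: ac_simps)
  show "2 * theta_bar lam \<mu> n / theta bb \<gamma> lam \<mu> n = 2 * (1 - lam 0) / T n"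
    unfolding theta_eqs
    using mult_divide_mult_cancel_left[OF S, of "2 * (1 - lam 0)" "T n"]
    by (simp only: ac_simps)
  show "theta_bar lam \<mu> n * \<gamma> n * bb / theta_hat bb \<gamma> lam \<mu> n = (1 - lam 0) * b n / N n"
    unfolding theta_eqs
    using mult_divide_mult_cancel_left[OF S, of "(1 - lam 0) * b n" "N n"]
    by (simp only: ac_simps)
  show "theta_tilde bb \<gamma> lam \<mu> n / theta_hat bb \<gamma> lam \<mu> n = b n / N n"
    unfolding theta_eqs by (rule mult_divide_mult_cancel_left[OF S])
  show "theta_hat bb \<gamma> lam \<mu> n / theta bb \<gamma> lam \<mu> n = N n / T n"
    unfolding theta_eqs by (rule mult_divide_mult_cancel_left[OF S])
qed

lemma alpha_0 [simp]: "alpha lam \<mu> 0 = 0"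
  using lam_pos[of 0] by (simp add: alpha_eq)

lemma run_eqs:
  "y n = x n + alpha lam \<mu> n *\<^sub>R (prev (x 0) y n - x n) + u n"
  "z n = x n + alpha lam \<mu> n *\<^sub>R (prev (x 0) p n - x n)
    + (alpha lam \<mu> n * (\<gamma> n / prev (\<gamma> 0) \<gamma> n)) *\<^sub>R (prev (x 0) z n - prev (x 0) p n)
    + ((1 - lam 0) * b n / N n) *\<^sub>R u n + v n"
  "x (Suc n) = x n + lam n *\<^sub>R (p n - z n)
    + (alpha lam \<mu> n * (\<gamma> n / prev (\<gamma> 0) \<gamma> n) * lam n) *\<^sub>R (prev (x 0) z n - prev (x 0) p n)"
  using run unfolding algorithm_run_def alpha_bar_eq coefficient_eqs by blast+

lemma run_start: "u 0 = 0" "v 0 = 0"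
  using run unfolding algorithm_run_def by blast+

lemma forward_backward_mem: "(1 / \<gamma> n) *\<^sub>R M (z n - p n) - C (y n) \<in> A (p n)"
proof -
  have "p n \<in> inverse_sum M (\<gamma> n) A (M (z n) - \<gamma> n *\<^sub>R C (y n))"
    using run unfolding algorithm_run_def by blast
  then obtain a where a: "a \<in> A (p n)" "M (z n) - \<gamma> n *\<^sub>R C (y n) = M (p n) + \<gamma> n *\<^sub>R a"
    by (auto simp: inverse_sum_def)
  have "\<gamma> n *\<^sub>R a = M (z n - p n) - \<gamma> n *\<^sub>R C (y n)"
    using a(2) by (simp add: linear_diff[OF linear_M] algebra_simps)
  then have "(1 / \<gamma> n) *\<^sub>R (\<gamma> n *\<^sub>R a) = (1 / \<gamma> n) *\<^sub>R (M (z n - p n) - \<gamma> n *\<^sub>R C (y n))"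
    by simp
  then have "a = (1 / \<gamma> n) *\<^sub>R M (z n - p n) - C (y n)"
    using gamma_pos[of n] by (simp add: scaleR_diff_right)
  with a(1) show ?thesis by simp
qed

lemma A_monotone: "a \<in> A r \<Longrightarrow> c \<in> A s \<Longrightarrow> 0 \<le> inner (a - c) (r - s)"
  using maximal unfolding maximally_monotone_def monotone_op_def by blast

lemma zerD: "xs \<in> zer_sum A C \<Longrightarrow> - C xs \<in> A xs"
  by (auto simp: zer_sum_def add_eq_0_iff2 minus_equation_iff) 

lemma zerI: "- C xs \<in> A xs \<Longrightarrow> xs \<in> zer_sum A C"
  by (force simp: zer_sum_def)

text \<open>Monotonicity of \<open>A\<close> between the inclusion at \<open>p\<^sub>n\<close> and \<open>- C x\<^sup>* \<in> A x\<^sup>*\<close>.\<close>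
lemma gap_monotone:
  assumes "xs \<in> zer_sum A C"
  shows "inner (C (y n) - C xs) (p n - xs) \<le> ip ((1 / \<gamma> n) *\<^sub>R (z n - p n)) (p n - xs)"
  using A_monotone[OF forward_backward_mem zerD[OF assms], of n]
  by (simp add: inner_simps inner_M_left ip_simps algebra_simps)

lemma gap_lower_bound:
  assumes "xs \<in> zer_sum A C"
  shows "(bb - \<beta>) / 4 * ip (y n - p n) (y n - p n) \<le> gap xs n"
proof -
  have "p n - xs - (y n - xs) = - (y n - p n)" by simp
  then have "ip (p n - xs - (y n - xs)) (p n - xs - (y n - xs)) = ip (y n - p n) (y n - p n)"
    by (simp only: ip_simps)
  then have "- (\<beta> / 4 * ip (y n - p n) (y n - p n)) \<le> inner (C (y n) - C xs) (p n - xs)"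
    using cocoercive_slack[OF cocoercive beta_nonneg, where a = "y n" and b = xs and d = "p n - xs"]
    by simp
  with gap_monotone[OF assms, of n] show ?thesis
    by (simp add: gap_def field_simps)
qed

lemma gap_nonneg: "xs \<in> zer_sum A C \<Longrightarrow> 0 \<le> gap xs n"
  using gap_lower_bound[of xs n] ip_nonneg[of "y n - p n"] beta_le
  by (smt (verit) divide_nonneg_nonneg mult_nonneg_nonneg)

lemma ell_eq:
  "decrease n = S n * T n / 2 * ip (res n) (res n)
    + 2 * \<mu> n * \<gamma> n * ip ((1 / \<gamma> n) *\<^sub>R (z n - p n)
        - (1 / prev (\<gamma> 0) \<gamma> n) *\<^sub>R (prev (x 0) z n - prev (x 0) p n)) (p n - prev (x 0) p n)
    + \<mu> n * b n / 2 * ip (p n - y n - (prev (x 0) p n - prev (x 0) y n))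
                         (p n - y n - (prev (x 0) p n - prev (x 0) y n))"
  by (simp add: ell_def norm_wrt_sq theta_eqs mult.assoc)

lemma mu_nonneg: "0 \<le> \<mu> n"
proof -
  have "0 \<le> alpha lam \<mu> n" using lam_ge[of n] lam_pos[of n] by (simp add: alpha_eq)
  with S_pos[of n] show ?thesis by (metis less_imp_le mu_eq_alpha mult_nonneg_nonneg)
qed

text \<open>The two remaining terms of \<open>\<ell>\<^sub>n\<close> are jointly non-negative, by monotonicity of \<open>A\<close> between
  the inclusions at steps \<open>n\<close> and \<open>n - 1\<close>. At \<open>n = 0\<close> there is no previous inclusion, but
  then \<open>\<mu>\<^sub>0 = 0\<close>.\<close>
lemma residual_le_decrease: "S n * T n / 2 * ip (res n) (res n) \<le> decrease n"
proof (cases n)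
  case 0
  have "\<mu> 0 = 0" by (simp add: mu_eq_alpha)
  with 0 show ?thesis by (simp add: ell_eq)
next
  case (Suc k)
  define d where "d = p n - p k"
  define f where "f = p n - y n - (p k - y k)"
  define c where "c = (1 / \<gamma> n) *\<^sub>R (z n - p n) - (1 / \<gamma> k) *\<^sub>R (z k - p k)"
  have f: "d - (y n - y k) = f" by (simp add: d_def f_def)
  have "- (\<beta> / 4 * ip f f) \<le> inner (C (y n) - C (y k)) d"
    using cocoercive_slack[OF cocoercive beta_nonneg, where a = "y n" and b = "y k" and d = d]
    by (simp only: f)
  also have "\<dots> \<le> ip c d"
    using A_monotone[OF forward_backward_mem[of n] forward_backward_mem[of k]]
    unfolding c_def d_def by (simp add: inner_simps inner_M_left ip_simps algebra_simps)
  finally have "- (\<beta> / 4 * ip f f) \<le> ip c d" .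
  moreover have "\<beta> / 4 * ip f f \<le> bb / 4 * ip f f"
    using beta_le ip_nonneg[of f] by (intro mult_right_mono) auto
  ultimately have "0 \<le> ip c d + bb / 4 * ip f f" by linarith
  then have "0 \<le> 2 * \<mu> n * \<gamma> n * (ip c d + bb / 4 * ip f f)"
    using mu_nonneg[of n] gamma_pos[of n] by simp
  then have "0 \<le> 2 * \<mu> n * \<gamma> n * ip c d + \<mu> n * b n / 2 * ip f f"
    by (simp add: algebra_simps)
  then show ?thesis unfolding ell_eq using Suc by (simp add: c_def d_def f_def)
qed

lemma decrease_nonneg: "0 \<le> decrease n"
  using residual_le_decrease[of n] S_pos[of n] T_bounds[of n] ip_nonneg[of "res n"]
  by (smt (verit) divide_nonneg_nonneg mult_nonneg_nonneg)

lemma residual_eq: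
  "res n = p n - x n + alpha lam \<mu> n *\<^sub>R (x n - prev (x 0) p n)
     + (b n * lam 0 / N n) *\<^sub>R u n - (2 * (1 - lam 0) / T n) *\<^sub>R v n"
  by (simp add: residual_def coefficient_eqs)

text \<open>The left-hand side of the safeguarding condition, extended to \<open>n = 0\<close>, where it vanishes since
  \<open>u\<^sub>0 = v\<^sub>0 = 0\<close>.\<close>
abbreviation "deviation n \<equiv> S n * (b n / N n * ip (u n) (u n) + N n / T n * ip (v n) (v n))"

text \<open>The substitution of the updates into \<open>energy_identity\<close>. At \<open>n = 0\<close> the artificial previous values are
  multiplied by \<open>\<alpha>\<^sub>0 = 0\<close>, which is why the default \<open>0\<close> for the previous gap is harmless.\<close>
lemma one_step_identity:
  "ip (x (Suc n) - xs) (x (Suc n) - xs) + 2 * \<gamma> n * lam n * gap xs n + decrease n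
    = ip (x n - xs) (x n - xs) + 2 * lam n * \<gamma> n * alpha lam \<mu> n * prev 0 (gap xs) n
      + deviation n"
proof -
  define a where "a = alpha lam \<mu> n"
  define r where "r = \<gamma> n / prev (\<gamma> 0) \<gamma> n"
  define X where "X = x n - xs"
  define P where "P = p n - xs"
  define P' where "P' = prev (x 0) p n - xs"
  define w where "w = prev (x 0) z n - prev (x 0) p n"
  define q where "q = prev (x 0) y n - prev (x 0) p n"
  define D where "D = P - (1 - a) *\<^sub>R X - a *\<^sub>R P'"
  define E where "E = ((1 - lam 0) * b n / N n) *\<^sub>R u n + v n - D"
  have lam: "S n * (1 - a) = lam n" and mu: "S n * a = \<mu> n"
    by (simp_all only: a_def lam_eq[symmetric] mu_eq_alpha[symmetric])
  have sq: "(S n * (1 - a))\<^sup>2 = S n * lam 0"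
    unfolding lam using lam_pos[of 0] by simp
  have R: "res n = D + (b n * lam 0 / N n) *\<^sub>R u n - (2 * (1 - lam 0) / T n) *\<^sub>R v n"
    unfolding residual_eq by (simp add: D_def P_def P'_def X_def a_def algebra_simps)
  have zp: "z n - p n = (a * r) *\<^sub>R w + E"
    using run_eqs(2)[of n]
    by (simp add: E_def D_def P_def P'_def X_def w_def a_def r_def algebra_simps)
  have yp: "y n - p n = u n - D + a *\<^sub>R q"
    using run_eqs(1)[of n] by (simp add: D_def P_def P'_def X_def q_def a_def algebra_simps)
  have x: "x (Suc n) - xs = X - lam n *\<^sub>R E"
  proof -
    have "x (Suc n) = x n - lam n *\<^sub>R (z n - p n) + lam n *\<^sub>R ((a * r) *\<^sub>R w)"
      unfolding run_eqs(3)[of n] by (simp add: a_def r_def w_def algebra_simps)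
    then show ?thesis by (simp add: zp X_def algebra_simps)
  qed
  have gap_now: "2 * \<gamma> n * lam n * gap xs n
      = 2 * lam n * ip (z n - p n) P + lam n * b n / 2 * ip (y n - p n) (y n - p n)"
    using gamma_pos[of n] unfolding gap_def P_def ip_simps(5) by (simp add: field_simps)
  have gap_prev: "2 * lam n * \<gamma> n * a * prev 0 (gap xs) n
      = lam n * a * (2 * r * ip w P' + b n / 2 * ip q q)"
  proof (cases n)
    case 0
    then show ?thesis by (simp add: a_def)
  next
    case (Suc k)
    have "\<gamma> k > 0" by (rule gamma_pos)
    then show ?thesis
      unfolding Suc r_def w_def P'_def q_def prev_simps gap_def ip_simps(5) by (simp add: field_simps)
  qed
  have *: "\<gamma> n * ip ((1 / \<gamma> n) *\<^sub>R (z n - p n)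
        - (1 / prev (\<gamma> 0) \<gamma> n) *\<^sub>R (prev (x 0) z n - prev (x 0) p n)) (p n - prev (x 0) p n)
      = ip (z n - p n - r *\<^sub>R w) (P - P')"
    unfolding ip_simps(5)[symmetric]
    using gamma_pos[of n] by (simp add: scaleR_diff_right r_def w_def P_def P'_def)
  have **: "p n - y n - (prev (x 0) p n - prev (x 0) y n) = q - (y n - p n)"
    by (simp add: q_def)
  have ell: "decrease n = S n * T n / 2 * ip (res n) (res n)
      + 2 * \<mu> n * ip (z n - p n - r *\<^sub>R w) (P - P')
      + \<mu> n * b n / 2 * ip (q - (y n - p n)) (q - (y n - p n))"
    unfolding ell_eq ** *[symmetric] by (simp only: mult.assoc)
  show ?thesis
    using energy_identity[where a = a and b = "b n" and L = "lam 0" and S = "S n" and r = r,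
        OF _ _ sq D_def E_def R zp yp] N_bounds(2)[of n] T_bounds(2)[of n]
    unfolding lam mu x gap_now gap_prev a_def[symmetric] ell X_def[symmetric] by simp
qed

end

section \<open>Lyapunov descent and its consequences\<close>

context forward_backward_run begin

lemma alpha_bounds: "0 \<le> alpha lam \<mu> n" "alpha lam \<mu> n \<le> 1"
  using lam_ge[of n] lam_pos[of n] lam_pos[of 0] by (simp_all add: alpha_eq)

lemma prev_decrease_nonneg: "0 \<le> prev 0 decrease n"
  using decrease_nonneg by (cases n) auto

lemma prev_gap_nonneg: "xs \<in> zer_sum A C \<Longrightarrow> 0 \<le> prev 0 (gap xs) n"
  using gap_nonneg by (cases n) auto

lemma deviation_le: "deviation n \<le> \<zeta> n * prev 0 decrease n"
proof (cases n)
  case 0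
  then show ?thesis by (simp add: run_start ip_simps)
next
  case (Suc k)
  have "(lam (Suc k) + \<mu> (Suc k)) *
      (theta_tilde bb \<gamma> lam \<mu> (Suc k) / theta_hat bb \<gamma> lam \<mu> (Suc k) * (norm_wrt M (u (Suc k)))\<^sup>2
       + theta_hat bb \<gamma> lam \<mu> (Suc k) / theta bb \<gamma> lam \<mu> (Suc k) * (norm_wrt M (v (Suc k)))\<^sup>2)
      \<le> \<zeta> (Suc k) * decrease k"
    using run unfolding algorithm_run_def by blast
  then show ?thesis
    unfolding Suc prev_simps coefficient_eqs lam_plus_mu norm_wrt_sq .
qed

lemma deviation_le_decrease: "deviation n \<le> prev 0 decrease n"
proof -
  have "\<zeta> n * prev 0 decrease n \<le> 1 * prev 0 decrease n"
    using zeta_bounds[of n] eps0_nonneg prev_decrease_nonneg by (intro mult_right_mono) auto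
  with deviation_le[of n] show ?thesis by simp
qed

lemma lyapunov_nonneg:
  assumes "xs \<in> zer_sum A C"
  shows "prev 0 decrease n \<le> lyapunov xs n" "0 \<le> lyapunov xs n"
    "ip (x n - xs) (x n - xs) \<le> lyapunov xs n"
proof -
  have "0 \<le> 2 * lam n * \<gamma> n * alpha lam \<mu> n * prev 0 (gap xs) n"
    using lam_pos[of n] gamma_pos[of n] alpha_bounds[of n] prev_gap_nonneg[OF assms, of n] by simp
  then show "prev 0 decrease n \<le> lyapunov xs n" "0 \<le> lyapunov xs n"
    "ip (x n - xs) (x n - xs) \<le> lyapunov xs n"
    using ip_nonneg[of "x n - xs"] prev_decrease_nonneg[of n] by (simp_all add: lyapunov_def)
qed

text \<open>Since \<open>\<lambda>\<^sub>n \<alpha>\<^sub>n = \<lambda>\<^sub>n - \<lambda>\<^sub>0\<close>, the step-size condition says that the weight of \<open>\<phi>\<^sub>n\<close> in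
  \<open>V\<^bsub>n+1\<^esub>\<close> is smaller by at least \<open>2 \<epsilon>\<^sub>1\<close> than the weight \<open>2 \<gamma>\<^sub>n \<lambda>\<^sub>n\<close> produced by the identity.\<close>
lemma lyapunov_descent:
  assumes xs: "xs \<in> zer_sum A C"
  shows "lyapunov xs (Suc n) + 2 * eps1 * gap xs n + eps0 * prev 0 decrease n \<le> lyapunov xs n"
proof -
  have la: "lam (Suc n) * alpha lam \<mu> (Suc n) = lam (Suc n) - lam 0"
    using lam_pos[of "Suc n"] by (simp add: alpha_eq field_simps)
  have "2 * lam (Suc n) * \<gamma> (Suc n) * alpha lam \<mu> (Suc n)
      = 2 * \<gamma> (Suc n) * (lam (Suc n) * alpha lam \<mu> (Suc n))" by simp
  also have "\<dots> \<le> 2 * \<gamma> n * lam n - 2 * eps1"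
    unfolding la using gamma_lam_step[of n] by (simp add: algebra_simps)
  finally have "2 * lam (Suc n) * \<gamma> (Suc n) * alpha lam \<mu> (Suc n) * gap xs n
      \<le> (2 * \<gamma> n * lam n - 2 * eps1) * gap xs n"
    by (rule mult_right_mono) (rule gap_nonneg[OF xs])
  moreover have "\<zeta> n * prev 0 decrease n \<le> (1 - eps0) * prev 0 decrease n"
    using zeta_bounds[of n] prev_decrease_nonneg by (intro mult_right_mono) auto
  ultimately show ?thesis
    using one_step_identity[of n xs] deviation_le[of n]
    unfolding lyapunov_def prev_simps left_diff_distrib by linarith
qed

lemma lyapunov_decreasing:
  assumes "xs \<in> zer_sum A C"
  shows "lyapunov xs (Suc n) \<le> lyapunov xs n"
proof -
  have "0 \<le> 2 * eps1 * gap xs n" "0 \<le> eps0 * prev 0 decrease n"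
    using eps0_nonneg eps1_nonneg gap_nonneg[OF assms] prev_decrease_nonneg by simp_all
  with lyapunov_descent[OF assms, of n] show ?thesis by linarith
qed

lemma lyapunov_convergent: "xs \<in> zer_sum A C \<Longrightarrow> convergent (lyapunov xs)"
  using lyapunov_decreasing lyapunov_nonneg(2)
  by (meson convergentI decseq_SucI decseq_convergent)

lemma lyapunov_le_initial:
  "xs \<in> zer_sum A C \<Longrightarrow> lyapunov xs n \<le> ip (x 0 - xs) (x 0 - xs)"
proof (induction n)
  case 0
  then show ?case by (simp add: lyapunov_def)
next
  case (Suc n)
  then show ?case using lyapunov_decreasing[of xs n] by simp
qed

lemma decrease_le_initial:
  "xs \<in> zer_sum A C \<Longrightarrow> decrease n \<le> ip (x 0 - xs) (x 0 - xs)"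
  using lyapunov_nonneg(1)[of xs "Suc n"] lyapunov_le_initial[of xs "Suc n"] by simp

lemma residual_rate:
  assumes "xs \<in> zer_sum A C"
  shows "ip (res n) (res n) \<le> 2 * lam 0 * ip (x 0 - xs) (x 0 - xs) / (T n * (lam n)\<^sup>2)"
proof -
  have "S n * T n / 2 * ip (res n) (res n) \<le> ip (x 0 - xs) (x 0 - xs)"
    using residual_le_decrease decrease_le_initial[OF assms] by (rule order_trans)
  moreover have "0 < T n * (lam n)\<^sup>2" using T_bounds(2) lam_pos[of n] by simp
  ultimately show ?thesis
    using lam_pos[of 0] by (simp add: pos_le_divide_eq pos_divide_le_eq ac_simps)
qed

lemma summable_decrease:
  assumes xs: "xs \<in> zer_sum A C" and "0 < eps0"
  shows "summable decrease"
proof -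
  have "summable (\<lambda>n. eps0 * prev 0 decrease n)"
  proof (rule summable_of_descent[where V = "lyapunov xs"])
    fix n
    show "lyapunov xs (Suc n) + eps0 * prev 0 decrease n \<le> lyapunov xs n"
      using lyapunov_descent[OF xs, of n] mult_nonneg_nonneg[OF eps1_nonneg gap_nonneg[OF xs, of n]]
      by linarith
  qed (use eps0_nonneg prev_decrease_nonneg lyapunov_nonneg(2)[OF xs] in auto)
  then have "summable (prev 0 decrease)"
    using \<open>0 < eps0\<close> by (subst (asm) summable_cmult_iff) auto
  then have "summable (\<lambda>n. prev 0 decrease (Suc n))" by (subst summable_Suc_iff)
  then show ?thesis by simp
qed

lemma summable_gap:
  assumes xs: "xs \<in> zer_sum A C" and "0 < eps1"
  shows "summable (gap xs)"
proof -
  have "summable (\<lambda>n. 2 * eps1 * gap xs n)"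
  proof (rule summable_of_descent[where V = "lyapunov xs"])
    fix n
    show "lyapunov xs (Suc n) + 2 * eps1 * gap xs n \<le> lyapunov xs n"
      using lyapunov_descent[OF xs, of n]
        mult_nonneg_nonneg[OF eps0_nonneg prev_decrease_nonneg[of n]] by linarith
  qed (use eps1_nonneg gap_nonneg[OF xs] lyapunov_nonneg(2)[OF xs] in auto)
  then show ?thesis
    using \<open>0 < eps1\<close> by (subst (asm) summable_cmult_iff) auto
qed

lemma summable_forward_backward_gap:
  assumes xs: "xs \<in> zer_sum A C" and "0 < eps1" and "\<beta> < bb"
  shows "summable (\<lambda>n. ip (y n - p n) (y n - p n))"
proof (rule summable_comparison_test')
  show "summable (\<lambda>n. 4 / (bb - \<beta>) * gap xs n)"
    by (intro summable_mult summable_gap[OF assms(1,2)])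
  fix n :: nat
  show "norm (ip (y n - p n) (y n - p n)) \<le> 4 / (bb - \<beta>) * gap xs n"
    using gap_lower_bound[OF xs, of n] \<open>\<beta> < bb\<close> ip_nonneg[of "y n - p n"]
    by (simp add: field_simps)
qed

lemma tendsto_zero_of_scaled_ip:
  assumes "f \<longlonglongrightarrow> 0" and "\<And>n. (lam n)\<^sup>2 * ip (s n) (s n) \<le> K * f n"
  shows "(\<lambda>n. lam n *\<^sub>R s n) \<longlonglongrightarrow> 0"
proof (rule tendsto_zero_of_ip, rule Lim_null_comparison)
  show "(\<lambda>n. K * f n) \<longlonglongrightarrow> 0"
    using tendsto_mult_left[OF assms(1), of K] by simp
  have "norm (ip (lam n *\<^sub>R s n) (lam n *\<^sub>R s n)) \<le> K * f n" for n
    using assms(2)[of n] ip_nonneg[of "lam n *\<^sub>R s n"]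
    by (simp add: ip_simps(5,6) power2_eq_square mult.assoc)
  then show "\<forall>\<^sub>F n in sequentially. norm (ip (lam n *\<^sub>R s n) (lam n *\<^sub>R s n)) \<le> K * f n"
    by (rule always_eventually[OF allI])
qed

lemma b_over_N_bounds: "eps / 2 \<le> b n / N n" "b n / N n \<le> 4 / (eps * lam 0)"
proof -
  have "0 < eps * lam 0" using eps_pos lam_pos[of 0] by simp
  then show "b n / N n \<le> 4 / (eps * lam 0)"
    by (intro frac_le[OF _ b_bounds(3) _ N_bounds(1)]) simp_all
  show "eps / 2 \<le> b n / N n"
    by (rule frac_le[OF less_imp_le[OF b_bounds(2)] b_bounds(1) N_bounds(2,3)])
qed

lemma N_over_T_lower: "eps * lam 0 / 4 \<le> N n / T n"
  by (rule frac_le[OF less_imp_le N_bounds(1) T_bounds(2,3), OF N_bounds(2)])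

lemma prev_decrease_tendsto:
  "xs \<in> zer_sum A C \<Longrightarrow> 0 < eps0 \<Longrightarrow> prev 0 decrease \<longlonglongrightarrow> 0"
  using LIMSEQ_imp_Suc[of "prev 0 decrease" 0] summable_LIMSEQ_zero[OF summable_decrease] by simp

text \<open>Both \<open>\<ell>\<^sub>n\<close> and the safeguarding bound control squared norms with weights that are at least a
  fixed multiple of \<open>\<lambda>\<^sub>n\<^sup>2\<close>.\<close>
lemma scaled_deviations_tendsto:
  assumes "xs \<in> zer_sum A C" and "0 < eps0"
  shows "(\<lambda>n. lam n *\<^sub>R u n) \<longlonglongrightarrow> 0" and "(\<lambda>n. lam n *\<^sub>R v n) \<longlonglongrightarrow> 0"
    and "(\<lambda>n. lam n *\<^sub>R res n) \<longlonglongrightarrow> 0"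
proof -
  note lim = prev_decrease_tendsto[OF assms]
  note lim' = summable_LIMSEQ_zero[OF summable_decrease[OF assms]]
  have nn: "0 \<le> S n * (b n / N n * ip (u n) (u n))" "0 \<le> S n * (N n / T n * ip (v n) (v n))" for n
    by (rule mult_nonneg_nonneg[OF less_imp_le[OF S_pos]],
        rule mult_nonneg_nonneg[OF divide_nonneg_nonneg ip_nonneg],
        rule less_imp_le[OF b_bounds(2)] less_imp_le[OF N_bounds(2)],
        rule less_imp_le[OF N_bounds(2)] less_imp_le[OF T_bounds(2)])+
  show "(\<lambda>n. lam n *\<^sub>R u n) \<longlonglongrightarrow> 0"
  proof (rule tendsto_zero_of_scaled_ip[OF lim, where K = "2 * lam 0 / eps"])
    fix n
    have "S n * (eps / 2 * ip (u n) (u n)) \<le> S n * (b n / N n * ip (u n) (u n))"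
      using S_pos[of n] b_over_N_bounds(1)[of n] ip_nonneg
      by (intro mult_left_mono mult_right_mono) auto
    also have "\<dots> \<le> prev 0 decrease n"
      using deviation_le_decrease[of n] nn(2)[of n] unfolding distrib_left by linarith
    finally show "(lam n)\<^sup>2 * ip (u n) (u n) \<le> 2 * lam 0 / eps * prev 0 decrease n"
      using eps_pos lam_pos[of 0] by (simp add: field_simps)
  qed
  show "(\<lambda>n. lam n *\<^sub>R v n) \<longlonglongrightarrow> 0"
  proof (rule tendsto_zero_of_scaled_ip[OF lim, where K = "4 / eps"])
    fix n
    have "S n * (eps * lam 0 / 4 * ip (v n) (v n)) \<le> S n * (N n / T n * ip (v n) (v n))"
      using S_pos[of n] N_over_T_lower[of n] ip_nonneg
      by (intro mult_left_mono mult_right_mono) auto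
    also have "\<dots> \<le> prev 0 decrease n"
      using deviation_le_decrease[of n] nn(1)[of n] unfolding distrib_left by linarith
    finally show "(lam n)\<^sup>2 * ip (v n) (v n) \<le> 4 / eps * prev 0 decrease n"
      using eps_pos lam_pos[of 0] by (simp add: field_simps)
  qed
  show "(\<lambda>n. lam n *\<^sub>R res n) \<longlonglongrightarrow> 0"
  proof (rule tendsto_zero_of_scaled_ip[OF lim', where K = "2 * lam 0 / eps"])
    fix n
    have "S n * eps / 2 * ip (res n) (res n) \<le> S n * T n / 2 * ip (res n) (res n)"
      using S_pos[of n] T_bounds(1)[of n] ip_nonneg
      by (intro mult_right_mono divide_right_mono mult_left_mono) auto
    also have "\<dots> \<le> decrease n" by (rule residual_le_decrease)
    finally show "(lam n)\<^sup>2 * ip (res n) (res n) \<le> 2 * lam 0 / eps * decrease n"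
      using eps_pos lam_pos[of 0] by (simp add: field_simps)
  qed
qed

text \<open>The increment is a combination of \<open>\<lambda>\<^sub>n\<close> times the residual, \<open>\<lambda>\<^sub>n u\<^sub>n\<close> and \<open>\<lambda>\<^sub>n v\<^sub>n\<close> with
  bounded coefficients.\<close>
lemma increments_tendsto:
  assumes "xs \<in> zer_sum A C" and "0 < eps0"
  shows "(\<lambda>n. x (Suc n) - x n) \<longlonglongrightarrow> 0"
proof -
  have eq: "x (Suc n) - x n = lam n *\<^sub>R res n - (b n / N n) *\<^sub>R (lam n *\<^sub>R u n)
      - ((2 - b n) / T n) *\<^sub>R (lam n *\<^sub>R v n)" for n
  proof -
    define k where "k = (1 - lam 0) * b n / N n"
    define g where "g = b n * lam 0 / N n"
    define h where "h = 2 * (1 - lam 0) / T n"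
    have g: "b n / N n = g + k"
      by (simp add: g_def k_def add_divide_distrib[symmetric] algebra_simps)
    have h: "(2 - b n) / T n = 1 - h"
      using T_bounds(2)[of n] by (simp add: h_def field_simps)
    show ?thesis
      unfolding g h residual_eq g_def[symmetric] h_def[symmetric] run_eqs(3)[of n] run_eqs(2)[of n]
        k_def[symmetric]
      by (simp add: algebra_simps)
  qed
  have 1: "\<bar>b n / N n\<bar> \<le> 4 / (eps * lam 0)" for n
    using b_over_N_bounds[of n] eps_pos by linarith
  have 2: "\<bar>(2 - b n) / T n\<bar> \<le> 2 / eps" for n
  proof -
    have "\<bar>2 - b n\<bar> / T n \<le> 2 / eps"
      using b_bounds[of n] T_bounds[of n] eps_pos by (intro frac_le) auto
    then show ?thesis using T_bounds(2)[of n] by simp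
  qed
  have "(\<lambda>n. lam n *\<^sub>R res n - (b n / N n) *\<^sub>R (lam n *\<^sub>R u n)
      - ((2 - b n) / T n) *\<^sub>R (lam n *\<^sub>R v n)) \<longlonglongrightarrow> 0 - 0 - 0"
    by (intro tendsto_diff scaled_deviations_tendsto[OF assms]
        tendsto_zero_scaleR_bounded[OF _ 1] tendsto_zero_scaleR_bounded[OF _ 2])
  then show ?thesis by (simp add: eq)
qed

section \<open>Weak convergence of the iterates\<close>

text \<open>Boundedness of \<open>\<lambda>\<close> is what makes the gap term of the Lyapunov function vanish: its weight
  \<open>2 \<lambda>\<^sub>n \<gamma>\<^sub>n \<alpha>\<^sub>n\<close> then stays bounded while the gap tends to zero.\<close>
lemma distance_convergent:
  assumes xs: "xs \<in> zer_sum A C" and "0 < eps0" "0 < eps1" and lam: "bounded (range lam)"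
  shows "convergent (\<lambda>n. ip (x n - xs) (x n - xs))"
proof -
  obtain B where B: "\<And>n. lam n \<le> B" using lam by (auto simp: bounded_iff abs_le_iff)
  define c where "c n = 2 * lam n * \<gamma> n * alpha lam \<mu> n" for n
  have c: "\<bar>c n\<bar> \<le> 2 * B * (4 / bb) * 1" for n
  proof -
    have "\<gamma> n \<le> 4 / bb" using b_bounds(3)[of n] bb_pos by (simp add: field_simps)
    moreover have "0 \<le> B" using B[of 0] lam_pos[of 0] by linarith
    ultimately have "2 * lam n * \<gamma> n \<le> 2 * B * (4 / bb)"
      using B[of n] less_imp_le[OF gamma_pos[of n]] less_imp_le[OF lam_pos[of n]]
      by (intro mult_mono) simp_all
    then have "2 * lam n * \<gamma> n * alpha lam \<mu> n \<le> 2 * B * (4 / bb) * 1"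
      by (rule mult_mono) (use alpha_bounds[of n] bb_pos \<open>0 \<le> B\<close> in simp_all)
    moreover have "0 \<le> c n"
      using lam_pos[of n] gamma_pos[of n] alpha_bounds(1)[of n] by (simp add: c_def)
    ultimately show ?thesis by (simp only: c_def[symmetric] abs_of_nonneg)
  qed
  have "(\<lambda>n. gap xs n) \<longlonglongrightarrow> 0" by (rule summable_LIMSEQ_zero[OF summable_gap[OF xs \<open>0 < eps1\<close>]])
  then have "prev 0 (gap xs) \<longlonglongrightarrow> 0"
    using LIMSEQ_imp_Suc[of "prev 0 (gap xs)" 0] by simp
  then have "(\<lambda>n. c n * prev 0 (gap xs) n) \<longlonglongrightarrow> 0"
    using tendsto_zero_scaleR_bounded[OF _ c, of "prev 0 (gap xs)"] by simp
  then have "convergent (\<lambda>n. lyapunov xs n - c n * prev 0 (gap xs) n - prev 0 decrease n)"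
    using prev_decrease_tendsto[OF xs \<open>0 < eps0\<close>] lyapunov_convergent[OF xs]
    by (intro convergent_diff) (auto intro: convergentI)
  then show ?thesis by (simp add: lyapunov_def c_def)
qed

text \<open>Strong convergence of \<open>C y\<^sub>n\<close> to \<open>C x\<^sup>*\<close> makes the elements
  \<open>M (z\<^sub>n - p\<^sub>n) / \<gamma>\<^sub>n - C y\<^sub>n\<close> of \<open>A p\<^sub>n\<close> converge strongly to \<open>- C x\<^sup>*\<close>, which therefore lies in
  \<open>A q\<close>; a second use of cocoercivity, now against \<open>q\<close>, identifies \<open>C x\<^sup>*\<close> with \<open>C q\<close>.\<close>
lemma zer_weak_cluster_point:
  assumes xs: "xs \<in> zer_sum A C" and G: "G \<noteq> bot" "G \<le> sequentially"
    and weak: "\<And>w. ((\<lambda>n. inner (p n) w) \<longlongrightarrow> inner q w) G"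
    and bd: "bounded (range p)"
    and yp: "(\<lambda>n. y n - p n) \<longlonglongrightarrow> 0" and zp: "(\<lambda>n. z n - p n) \<longlonglongrightarrow> 0"
  shows "q \<in> zer_sum A C"
proof -
  define w where "w n = (1 / \<gamma> n) *\<^sub>R (z n - p n)" for n
  have "\<bar>1 / \<gamma> n\<bar> \<le> bb / eps" for n
    using b_bounds(1)[of n] gamma_pos[of n] eps_pos by (simp add: field_simps)
  then have "w \<longlonglongrightarrow> 0"
    unfolding w_def by (rule tendsto_zero_scaleR_bounded[OF zp])
  then have Mw: "(\<lambda>n. M (w n)) \<longlonglongrightarrow> 0"
    using tendsto_M[of w 0] linear_0[OF linear_M] by simp
  have bd_diff: "bounded (range (\<lambda>n. p n - xs))"
    using bounded_minus_comp[OF bd, of "\<lambda>_. xs"] by simp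
  \<comment> \<open>cocoercivity turns the vanishing of the monotonicity gap into strong convergence of C\<close>
  have Cy: "(\<lambda>n. C (y n)) \<longlonglongrightarrow> C xs"
  proof (rule tendsto_of_dual_ip, rule Lim_null_comparison)
    have "(\<lambda>n. inner (p n - xs) (M (w n))) \<longlonglongrightarrow> 0"
      by (rule tendsto_inner_bounded_null[OF bd_diff Mw])
    moreover have "(\<lambda>n. inner (y n - p n) (M (y n - p n))) \<longlonglongrightarrow> inner 0 (M 0)"
      by (rule tendsto_inner[OF yp tendsto_M[OF yp]])
    ultimately have "(\<lambda>n. 2 * \<beta> * inner (p n - xs) (M (w n))
        + \<beta>\<^sup>2 * inner (y n - p n) (M (y n - p n))) \<longlonglongrightarrow> 2 * \<beta> * 0 + \<beta>\<^sup>2 * inner 0 (M 0)"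
      by (intro tendsto_add tendsto_mult_left)
    then show "(\<lambda>n. 2 * \<beta> * ip (p n - xs) (w n) + \<beta>\<^sup>2 * ip (y n - p n) (y n - p n)) \<longlonglongrightarrow> 0"
      by (simp add: inner_wrt_def)
    have "ip (inv M (C (y n) - C xs)) (inv M (C (y n) - C xs))
      \<le> 2 * \<beta> * ip (p n - xs) (w n) + \<beta>\<^sup>2 * ip (y n - p n) (y n - p n)" for n
    proof -
      have "p n - xs - (y n - xs) = - (y n - p n)" by simp
      then have flip: "ip (p n - xs - (y n - xs)) (p n - xs - (y n - xs)) = ip (y n - p n) (y n - p n)"
        by (simp only: ip_simps)
      have "2 * \<beta> * inner (C (y n) - C xs) (p n - xs) \<le> 2 * \<beta> * ip (p n - xs) (w n)"
        using gap_monotone[OF xs, of n] beta_nonneg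
        by (intro mult_left_mono) (auto simp: w_def ip_commute)
      then show ?thesis
        using cocoercive_dual_bound[OF cocoercive, where a = "y n" and b = xs and d = "p n - xs"]
        unfolding flip by linarith
    qed
    then show "\<forall>\<^sub>F n in sequentially. norm (ip (inv M (C (y n) - C xs)) (inv M (C (y n) - C xs)))
      \<le> 2 * \<beta> * ip (p n - xs) (w n) + \<beta>\<^sup>2 * ip (y n - p n) (y n - p n)"
      using ip_nonneg by (intro always_eventually allI) simp
  qed
  have "(\<lambda>n. M (w n) - C (y n)) \<longlonglongrightarrow> 0 - C xs" by (intro tendsto_intros Mw Cy)
  moreover have "M (w n) - C (y n) \<in> A (p n)" for n
    using forward_backward_mem[of n] by (simp add: w_def linear_cmul[OF linear_M])
  ultimately have Aq: "- C xs \<in> A q"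
    using maximally_monotone_demiclosed[OF maximal G(1) _ bd weak tendsto_mono[OF G(2)],
        of "\<lambda>n. M (w n) - C (y n)" "- C xs"]
    by simp
  \<comment> \<open>it remains to identify \<open>C xs\<close> with \<open>C q\<close>, along \<open>G\<close> where \<open>p\<close> converges weakly to \<open>q\<close>\<close>
  have ypG: "((\<lambda>n. y n - p n) \<longlongrightarrow> 0) G" and CyG: "((\<lambda>n. C (y n)) \<longlongrightarrow> C xs) G"
    using tendsto_mono[OF G(2)] yp Cy by blast+
  have "((\<lambda>n. C (y n)) \<longlongrightarrow> C q) G"
  proof (rule tendsto_of_dual_ip, rule Lim_null_comparison)
    have CG: "((\<lambda>n. C (y n) - C q) \<longlongrightarrow> C xs - C q) G" by (intro tendsto_intros CyG)
    have "((\<lambda>n. inner (p n) (C (y n) - C q) + inner (y n - p n - q) (C (y n) - C q))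
        \<longlongrightarrow> inner q (C xs - C q) + inner (0 - q) (C xs - C q)) G"
      by (intro tendsto_intros tendsto_inner_weak_strong[OF bd weak] CG ypG)
    moreover have "inner (p n) (C (y n) - C q) + inner (y n - p n - q) (C (y n) - C q)
        = inner (C (y n) - C q) (y n - q)" for n
      by (simp add: inner_diff_left inner_diff_right inner_commute)
    ultimately have "((\<lambda>n. inner (C (y n) - C q) (y n - q)) \<longlongrightarrow> 0) G"
      by (simp add: inner_add_left[symmetric])
    from tendsto_mult_left[OF this, of \<beta>]
    show "((\<lambda>n. \<beta> * inner (C (y n) - C q) (y n - q)) \<longlongrightarrow> 0) G" by simp
    show "\<forall>\<^sub>F n in G. norm (ip (inv M (C (y n) - C q)) (inv M (C (y n) - C q)))
        \<le> \<beta> * inner (C (y n) - C q) (y n - q)"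
      using cocoerciveD[OF cocoercive] ip_nonneg by (intro always_eventually allI) simp
  qed
  from tendsto_unique[OF G(1) this CyG] Aq show ?thesis by (intro zerI) simp
qed

text \<open>Opial's argument: for two cluster points \<open>q\<close> and \<open>q'\<close>, the difference of the squared distances
  of \<open>x\<^sub>n\<close> to them converges, hence so does \<open>ip (x n) (q - q')\<close>. Its limit can be computed along
  either filter, which gives \<open>ip (q - q') (q - q') = 0\<close>.\<close>
lemma weak_convergence:
  assumes xs: "xs \<in> zer_sum A C" and "0 < eps0" "0 < eps1" and lam: "bounded (range lam)"
    and px: "(\<lambda>n. p n - x n) \<longlonglongrightarrow> 0"
    and yp: "(\<lambda>n. y n - p n) \<longlonglongrightarrow> 0" and zp: "(\<lambda>n. z n - p n) \<longlonglongrightarrow> 0"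
  shows "\<exists>q\<in>zer_sum A C. weakly_convergent_to p q"
proof (rule weakly_convergent_if_unique_cluster_point)
  have "ip (x n - xs) (x n - xs) \<le> lyapunov xs 0" for n
    using lyapunov_nonneg(3)[OF xs] lyapunov_le_initial[OF xs]
    by (rule order_trans[OF order_trans]) (simp add: lyapunov_def)
  then have "bounded (range (\<lambda>n. x n - xs))" by (rule bounded_of_ip)
  moreover have "bounded (range (\<lambda>n. p n - x n))"
    by (rule convergent_imp_bounded[OF px])
  ultimately have "bounded (range (\<lambda>n. (x n - xs) + (p n - x n) + xs))"
    by (intro bounded_plus_comp) auto
  then show bd: "bounded (range p)" by simp
  show "q \<in> zer_sum A C"
    if "G \<noteq> bot" "G \<le> sequentially" "\<And>w. ((\<lambda>n. inner (p n) w) \<longlongrightarrow> inner q w) G" for G q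
    using zer_weak_cluster_point[OF xs that bd yp zp] .
  fix G G' q q'
  assume G: "G \<noteq> bot" "G \<le> sequentially" "\<And>w. ((\<lambda>n. inner (p n) w) \<longlongrightarrow> inner q w) G"
    and G': "G' \<noteq> bot" "G' \<le> sequentially" "\<And>w. ((\<lambda>n. inner (p n) w) \<longlongrightarrow> inner q' w) G'"
  have q: "q \<in> zer_sum A C" "q' \<in> zer_sum A C"
    using zer_weak_cluster_point[OF xs G bd yp zp] zer_weak_cluster_point[OF xs G' bd yp zp] by auto
  define d where "d = q - q'"
  have "ip (x n) d = (ip (x n - q') (x n - q') - ip (x n - q) (x n - q) + ip q q - ip q' q') / 2" for n
    by (simp add: d_def ip_simps ip_commute[of q "x n"] ip_commute[of q' "x n"] field_simps)
  moreover have "convergent (\<lambda>n. (ip (x n - q') (x n - q') - ip (x n - q) (x n - q)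
      + ip q q - ip q' q') / 2)"
  proof -
    obtain c c' where "(\<lambda>n. ip (x n - q) (x n - q)) \<longlonglongrightarrow> c" "(\<lambda>n. ip (x n - q') (x n - q')) \<longlonglongrightarrow> c'"
      using distance_convergent[OF q(1) assms(2-4)] distance_convergent[OF q(2) assms(2-4)]
      by (auto simp: convergent_def)
    then have "(\<lambda>n. (ip (x n - q') (x n - q') - ip (x n - q) (x n - q) + ip q q - ip q' q') / 2)
        \<longlonglongrightarrow> (c' - c + ip q q - ip q' q') / 2"
      by (intro tendsto_intros) auto
    then show ?thesis by (rule convergentI)
  qed
  ultimately obtain c where "(\<lambda>n. ip (x n) d) \<longlonglongrightarrow> c" by (auto simp: convergent_def)
  moreover have "(\<lambda>n. inner (p n - x n) (M d)) \<longlonglongrightarrow> inner 0 (M d)"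
    by (intro tendsto_intros px)
  ultimately have "(\<lambda>n. ip (x n) d + inner (p n - x n) (M d)) \<longlonglongrightarrow> c + inner 0 (M d)"
    by (rule tendsto_add)
  then have lim: "(\<lambda>n. inner (p n) (M d)) \<longlonglongrightarrow> c"
    by (simp add: inner_wrt_def inner_diff_left)
  have "inner q (M d) = c" "inner q' (M d) = c"
    using tendsto_unique[OF G(1) G(3) tendsto_mono[OF G(2) lim]]
      tendsto_unique[OF G'(1) G'(3) tendsto_mono[OF G'(2) lim]] .
  then have "ip d d = 0" by (simp add: d_def inner_wrt_def inner_diff_left)
  then show "q = q'" by (simp add: ip_self_eq_0 d_def)
qed

text \<open>With constant \<open>\<lambda>\<close> there is no inertia (\<open>\<alpha>\<^sub>n = 0\<close>), so the residual is \<open>p\<^sub>n - x\<^sub>n\<close> up to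
  deviations, and the deviations themselves vanish because \<open>\<lambda>\<^sub>n\<close> is a positive constant.\<close>
lemma constant_relaxation_tendsto:
  assumes xs: "xs \<in> zer_sum A C" and "0 < eps0" and const: "\<forall>n. lam n = lam 0"
  shows "(\<lambda>n. p n - x n) \<longlonglongrightarrow> 0" and "(\<lambda>n. y n - p n) \<longlonglongrightarrow> 0"
    and "(\<lambda>n. z n - p n) \<longlonglongrightarrow> 0"
proof -
  have alpha: "alpha lam \<mu> n = 0" for n
    using const[rule_format, of n] lam_pos[of 0] by (simp add: alpha_eq)
  have unscale: "s \<longlonglongrightarrow> 0" if "(\<lambda>n. lam n *\<^sub>R s n) \<longlonglongrightarrow> 0" for s :: "nat \<Rightarrow> 'a"
  proof -
    have "(\<lambda>n. (1 / lam 0) *\<^sub>R (lam n *\<^sub>R s n)) \<longlonglongrightarrow> (1 / lam 0) *\<^sub>R 0"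
      by (intro tendsto_intros that)
    moreover have "(1 / lam 0) *\<^sub>R (lam n *\<^sub>R s n) = s n" for n
      using const[rule_format, of n] lam_pos[of 0] by simp
    ultimately show ?thesis by simp
  qed
  have u: "u \<longlonglongrightarrow> 0" and v: "v \<longlonglongrightarrow> 0" and r: "res \<longlonglongrightarrow> 0"
    using scaled_deviations_tendsto[OF assms(1,2)] by (auto intro: unscale)
  have k: "\<bar>(1 - lam 0) * b n / N n\<bar> \<le> \<bar>1 - lam 0\<bar> * (4 / (eps * lam 0))"
   and g: "\<bar>b n * lam 0 / N n\<bar> \<le> lam 0 * (4 / (eps * lam 0))"
   and h: "\<bar>2 * (1 - lam 0) / T n\<bar> \<le> \<bar>2 * (1 - lam 0)\<bar> / eps" for n
  proof -
    have "0 \<le> b n / N n" using b_over_N_bounds(1)[of n] eps_pos by linarith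
    then have bN: "\<bar>b n / N n\<bar> \<le> 4 / (eps * lam 0)"
      using b_over_N_bounds(2)[of n] by (simp only: abs_of_nonneg)
    show "\<bar>(1 - lam 0) * b n / N n\<bar> \<le> \<bar>1 - lam 0\<bar> * (4 / (eps * lam 0))"
      using mult_left_mono[OF bN, of "\<bar>1 - lam 0\<bar>"] by (simp add: abs_mult)
    show "\<bar>b n * lam 0 / N n\<bar> \<le> lam 0 * (4 / (eps * lam 0))"
      using mult_left_mono[OF bN, of "\<bar>lam 0\<bar>"] lam_pos[of 0] by (simp add: abs_mult ac_simps)
    show "\<bar>2 * (1 - lam 0) / T n\<bar> \<le> \<bar>2 * (1 - lam 0)\<bar> / eps"
      unfolding abs_divide using T_bounds[of n] eps_pos by (intro frac_le) auto
  qed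
  have px_eq: "p n - x n = res n - (b n * lam 0 / N n) *\<^sub>R u n + (2 * (1 - lam 0) / T n) *\<^sub>R v n" for n
    by (simp add: residual_eq alpha)
  have "(\<lambda>n. res n - (b n * lam 0 / N n) *\<^sub>R u n + (2 * (1 - lam 0) / T n) *\<^sub>R v n) \<longlonglongrightarrow> 0 - 0 + 0"
    by (intro tendsto_diff tendsto_add r tendsto_zero_scaleR_bounded[OF u g]
        tendsto_zero_scaleR_bounded[OF v h])
  then show px: "(\<lambda>n. p n - x n) \<longlonglongrightarrow> 0" by (simp add: px_eq)
  have "(\<lambda>n. u n - (p n - x n)) \<longlonglongrightarrow> 0 - 0" by (intro tendsto_diff u px)
  moreover have "u n - (p n - x n) = y n - p n" for n
    using run_eqs(1)[of n] by (simp add: alpha)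
  ultimately show "(\<lambda>n. y n - p n) \<longlonglongrightarrow> 0" by simp
  have "(\<lambda>n. ((1 - lam 0) * b n / N n) *\<^sub>R u n + v n - (p n - x n)) \<longlonglongrightarrow> 0 + 0 - 0"
    by (intro tendsto_diff tendsto_add tendsto_zero_scaleR_bounded[OF u k] v px)
  moreover have "((1 - lam 0) * b n / N n) *\<^sub>R u n + v n - (p n - x n) = z n - p n" for n
    using run_eqs(2)[of n] by (simp add: alpha)
  ultimately show "(\<lambda>n. z n - p n) \<longlonglongrightarrow> 0" by simp
qed

end

section \<open>Convergence of the algorithm\<close>

theorem theorem3:
  fixes M :: "'a::{real_inner, complete_space} \<Rightarrow> 'a"
    and A :: "'a \<Rightarrow> 'a set"
    and C :: "'a \<Rightarrow> 'a"
    and \<beta> bb eps eps0 eps1 :: real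
    and \<gamma> lam \<mu> \<zeta> :: "nat \<Rightarrow> real"
    and x y z p u v :: "nat \<Rightarrow> 'a"
    and xs :: 'a
    and l \<phi> V :: "nat \<Rightarrow> real"
  assumes M: "strongly_positive_op M"
    and A: "maximally_monotone A"
    and \<beta>: "0 \<le> \<beta>"
    and C: "cocoercive_wrt M \<beta> C"
    and zer: "zer_sum A C \<noteq> {}"
    and eps: "0 < eps"
    and eps0: "0 \<le> eps0"
    and eps1: "0 \<le> eps1"
    and \<gamma>_pos: "\<And>n. 0 < \<gamma> n"
    and lam_pos: "\<And>n. 0 < lam n"
    and \<mu>_nonneg: "\<And>n. 0 \<le> \<mu> n"
    and \<mu>: "\<And>n. \<mu> n = (1 / lam 0) * (lam n)\<^sup>2 - lam n"
    and \<zeta>: "\<And>n. 0 \<le> \<zeta> n \<and> \<zeta> n \<le> 1 - eps0"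
    and \<gamma>_bounds: "\<And>n. eps \<le> \<gamma> n * bb \<and> \<gamma> n * bb \<le> 4 - 2 * lam 0 - eps"
    and lam_step: "\<And>n. lam n \<le> lam (Suc n)"
    and \<gamma>_lam_step: "\<And>n. \<gamma> (Suc n) * lam (Suc n) - \<gamma> n * lam n \<le> \<gamma> (Suc n) * lam 0 - eps1"
    and bb: "\<beta> \<le> bb"
    and run: "algorithm_run M A C bb \<gamma> lam \<mu> \<zeta> x y z p u v"
    and xs: "xs \<in> zer_sum A C"
    and l: "\<And>n. l n = ell M bb \<gamma> lam \<mu> x y z p u v n"
    and \<phi>: "\<And>n. \<phi> n = inner_wrt M ((1 / \<gamma> n) *\<^sub>R (z n - p n)) (p n - xs)
                   + bb / 4 * (norm_wrt M (y n - p n))\<^sup>2"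
    and V_0: "V 0 = (norm_wrt M (x 0 - xs))\<^sup>2"
    and V_Suc: "\<And>n. V (Suc n) = (norm_wrt M (x (Suc n) - xs))\<^sup>2
                   + 2 * lam (Suc n) * \<gamma> (Suc n) * alpha lam \<mu> (Suc n) * \<phi> n + l n"
  shows "(convergent V \<and> (\<forall>n. l n \<le> V (Suc n) \<and> V (Suc n) \<le> (norm_wrt M (x 0 - xs))\<^sup>2))
    \<and> (incseq lam \<and> filterlim lam at_top sequentially \<longrightarrow>
         (\<forall>n. (norm_wrt M
                 (p n - x n + alpha lam \<mu> n *\<^sub>R (x n - prev (x 0) p n)
                  + (\<gamma> n * bb * (lam n)\<^sup>2 / theta_hat bb \<gamma> lam \<mu> n) *\<^sub>R u n
                  - (2 * theta_bar lam \<mu> n / theta bb \<gamma> lam \<mu> n) *\<^sub>R v n))\<^sup>2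
              \<le> 2 * lam 0 * (norm_wrt M (x 0 - xs))\<^sup>2
                 / ((4 - \<gamma> n * bb - 2 * lam 0) * (lam n)\<^sup>2)))
    \<and> (0 < eps0 \<longrightarrow> summable l)
    \<and> (0 < eps0 \<longrightarrow>
         (\<lambda>n. lam n *\<^sub>R u n) \<longlonglongrightarrow> 0 \<and> (\<lambda>n. lam n *\<^sub>R v n) \<longlonglongrightarrow> 0
         \<and> (\<lambda>n. x (Suc n) - x n) \<longlonglongrightarrow> 0)
    \<and> (0 < eps1 \<longrightarrow> summable \<phi>)
    \<and> (0 < eps1 \<and> \<beta> < bb \<longrightarrow> summable (\<lambda>n. (norm_wrt M (y n - p n))\<^sup>2))
    \<and> (0 < eps0 \<and> 0 < eps1 \<and> bounded (range lam)
         \<and> (\<lambda>n. p n - x n) \<longlonglongrightarrow> 0 \<and> (\<lambda>n. y n - p n) \<longlonglongrightarrow> 0 \<and> (\<lambda>n. z n - p n) \<longlonglongrightarrow> 0 \<longrightarrow>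
         (\<exists>q \<in> zer_sum A C. weakly_convergent_to p q))
    \<and> (0 < eps0 \<and> 0 < eps1 \<and> (\<forall>n. lam n = lam 0) \<longrightarrow>
         (\<exists>q \<in> zer_sum A C. weakly_convergent_to p q))"
proof -
  interpret forward_backward_run M A C \<beta> bb eps eps0 eps1 \<gamma> lam \<mu> \<zeta> x y z p u v
    by unfold_locales (fact assms)+
  have V: "V = lyapunov xs"
  proof
    fix n
    have \<phi>_gap: "\<phi> = gap xs" by (intro ext) (simp add: \<phi> gap_def norm_wrt_sq)
    show "V n = lyapunov xs n"
      by (cases n) (simp_all add: V_0 V_Suc lyapunov_def norm_wrt_sq \<phi>_gap l)
  qed
  have \<phi>_gap: "\<phi> = gap xs" by (intro ext) (simp add: \<phi> gap_def norm_wrt_sq)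
  have l_decrease: "l = decrease" by (intro ext) (simp add: l)
  have bounded_lam: "bounded (range lam)" if "\<forall>n. lam n = lam 0"
  proof -
    have "range lam \<subseteq> {lam 0}" using that by blast
    then show ?thesis by (rule bounded_subset[rotated]) simp
  qed
  show ?thesis
    unfolding V \<phi>_gap l_decrease norm_wrt_sq residual_def[symmetric]
    using lyapunov_convergent[OF xs] lyapunov_nonneg(1)[OF xs, of "Suc n" for n]
      lyapunov_le_initial[OF xs] residual_rate[OF xs] summable_decrease[OF xs]
      scaled_deviations_tendsto[OF xs] increments_tendsto[OF xs] summable_gap[OF xs]
      summable_forward_backward_gap[OF xs] weak_convergence[OF xs]
      constant_relaxation_tendsto[OF xs] bounded_lam
    by (simp)
qed

end
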